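(* Let $d,N\ge 1$ be integers, $K\ge 0$, and $V:\mathbb R^d\to\mathbb R$ a potential. Let $(\psi_1,\dots,\psi_N)$, $\psi_j=\psi_j(t,x)$, be a smooth solution (with enough decay in $x$ for the expressions below to make sense) of the Schrödinger–Lohe system with identical potentials $$ i\,\partial_t\psi_j=-\tfrac12\Delta\psi_j+V\psi_j+\frac{iK}{2N}\sum_{k=1}^N\big(\psi_k-\langle\psi_k,\psi_j\rangle\psi_j\big),\qquad t>0,\ x\in\mathbb R^d,\ 1\le j\le N, $$ with $\|\psi_j(0)\|_{L^2(\mathbb R^d)}=1$ for all $j$. Put $w_j:=w[\psi_j,\psi_j]$, $w_{jk}:=w[\psi_j,\psi_k]$, $w_{jk}^+:=\operatorname{Re}w_{jk}$, $w_{jk}^-:=\operatorname{Im}w_{jk}$, where $w[\cdot,\cdot]$ is the Wigner transform. Then for all $1\le j,k\le N$, with $x,p\in\mathbb R^d$ and $t>0$, $$ \partial_t w_j+p\cdot\nabla_x w_j+\Theta[V](w_j)=\frac KN\sum_{k=1}^N\Big[w_{jk}^+-\Big(\int w_{jk}^+\,dp\,dx\Big)w_j\Big], $$ $$ \partial_t w_{jk}^++p\cdot\nabla_x w_{jk}^++\Theta[V](w_{jk}^+)=\frac K{2N}\sum_{\ell=1}^N\Big[w_{j\ell}^++w_{\ell k}^+-\Big(\int (w_{j\ell}^++w_{\ell k}^+)\,dp\,dx\Big)w_{jk}^++\Big(\int (w_{j\ell}^-+w_{\ell k}^-)\,dp\,dx\Big)w_{jk}^-\Big], $$ $$ \partial_t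 w_{jk}^-+p\cdot\nabla_x w_{jk}^-+\Theta[V](w_{jk}^-)=\frac K{2N}\sum_{\ell=1}^N\Big[w_{j\ell}^-+w_{\ell k}^--\Big(\int (w_{j\ell}^++w_{\ell k}^+)\,dp\,dx\Big)w_{jk}^--\Big(\int (w_{j\ell}^-+w_{\ell k}^-)\,dp\,dx\Big)w_{jk}^+\Big]. $$
   Context: The inner product is $\langle f,g\rangle=\int_{\mathbb R^d}\bar f g\,dx$. For $\psi,\phi\in L^2(\mathbb R^d)$ the Wigner transform is $$ w[\psi,\phi](x,p)=\frac1{(2\pi)^d}\int_{\mathbb R^d}e^{iy\cdot p}\,\bar\psi\big(x+\tfrac y2\big)\phi\big(x-\tfrac y2\big)\,dy, $$ and it is applied at each fixed time $t$. The operator $\Theta[V]$ is $$ \Theta[V](w)(x,p)=-\frac{i}{(2\pi)^d}\int e^{i(p-p')\cdot y}\Big(V\big(x+\tfrac y2\big)-V\big(x-\tfrac y2\big)\Big)w(x,p')\,dp'\,dy. $$ Integrals $\int\cdot\,dp\,dx$ are over the whole phase space $\mathbb R^d\times\mathbb R^d$, and are understood consistently with the basic identity $\int w[f,g](x,p)\,dx\,dp=\langle f,g\rangle$. *)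

theory Defs
  imports "HOL-Analysis.Analysis"
begin

text \<open>The type \<open>'a::euclidean_space\<close> plays the role of \<open>\<real>\<^sup>d\<close>, with \<open>d = DIM('a) \<ge> 1\<close>.
  A wave function is a map \<open>\<psi> t x\<close>, a phase space function is a map \<open>w t x p\<close>.\<close>

definition pdiff :: "'b::euclidean_space \<Rightarrow> ('b \<Rightarrow> complex) \<Rightarrow> 'b \<Rightarrow> complex" where
  "pdiff b f x = frechet_derivative f (at x) b"

definition laplacian :: "('b::euclidean_space \<Rightarrow> complex) \<Rightarrow> 'b \<Rightarrow> complex" where
  "laplacian f x = (\<Sum>b\<in>Basis. pdiff b (pdiff b f) x)"

definition time_deriv :: "(real \<Rightarrow> complex) \<Rightarrow> real \<Rightarrow> complex" where
  "time_deriv f t = vector_derivative f (at t)"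

text \<open>\<open>C\<^sup>k\<close> and \<open>C\<^sup>\<infinity>\<close> regularity; only meant for open \<open>S\<close>.\<close>

primrec Ck_on :: "nat \<Rightarrow> 'b::euclidean_space set \<Rightarrow> ('b \<Rightarrow> complex) \<Rightarrow> bool" where
  "Ck_on 0 S f \<longleftrightarrow> continuous_on S f"
| "Ck_on (Suc n) S f \<longleftrightarrow> f differentiable_on S \<and> (\<forall>b\<in>Basis. Ck_on n S (pdiff b f))"

definition smooth_on :: "'b::euclidean_space set \<Rightarrow> ('b \<Rightarrow> complex) \<Rightarrow> bool" where
  "smooth_on S f \<longleftrightarrow> (\<forall>n. Ck_on n S f)"

text \<open>Polynomial decay in \<open>x\<close> at a rate faster than \<open>d/2\<close> (the threshold for square
  integrability), locally uniformly in \<open>t > 0\<close>.\<close>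

definition decays :: "(real \<Rightarrow> 'a::euclidean_space \<Rightarrow> complex) \<Rightarrow> bool" where
  "decays f \<longleftrightarrow> (\<forall>a b. 0 < a \<longrightarrow> a \<le> b \<longrightarrow>
     (\<exists>m C. m > real DIM('a) / 2 \<and>
        (\<forall>t\<in>{a..b}. \<forall>x. norm (f t x) \<le> C * (1 + norm x) powr (- m))))"

text \<open>A wave function that is smooth for \<open>t > 0\<close>, continuous up to \<open>t = 0\<close>, and has enough decay:
  its time derivative and all its iterated space derivatives decay as above.\<close>

definition smooth_decaying :: "(real \<Rightarrow> 'a::euclidean_space \<Rightarrow> complex) \<Rightarrow> bool" where
  "smooth_decaying \<psi> \<longleftrightarrow>
     smooth_on ({0<..} \<times> UNIV) (\<lambda>(t, x). \<psi> t x) \<and>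
     continuous_on ({0..} \<times> UNIV) (\<lambda>(t, x). \<psi> t x) \<and>
     decays (\<lambda>t x. time_deriv (\<lambda>s. \<psi> s x) t) \<and>
     (\<forall>bs. set bs \<subseteq> Basis \<longrightarrow> decays (\<lambda>t. foldr pdiff bs (\<psi> t)))"

definition l2_inner :: "('a::euclidean_space \<Rightarrow> complex) \<Rightarrow> ('a \<Rightarrow> complex) \<Rightarrow> complex" where
  "l2_inner f g = (\<integral>x. cnj (f x) * g x \<partial>lborel)"

definition l2_norm :: "('a::euclidean_space \<Rightarrow> complex) \<Rightarrow> real" where
  "l2_norm f = sqrt (\<integral>x. (norm (f x))\<^sup>2 \<partial>lborel)"

definition schroedinger_lohe ::
  "nat \<Rightarrow> real \<Rightarrow> ('a::euclidean_space \<Rightarrow> real) \<Rightarrow> (nat \<Rightarrow> real \<Rightarrow> 'a \<Rightarrow> complex) \<Rightarrow> bool" where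
  "schroedinger_lohe N K V \<psi> \<longleftrightarrow>
     (\<forall>j\<in>{1..N}. \<forall>t>0. \<forall>x.
        \<i> * time_deriv (\<lambda>s. \<psi> j s x) t =
          - (1/2) * laplacian (\<psi> j t) x + of_real (V x) * \<psi> j t x
          + \<i> * of_real K / (2 * of_nat N) *
            (\<Sum>k=1..N. \<psi> k t x - l2_inner (\<psi> k t) (\<psi> j t) * \<psi> j t x))"

definition wigner :: "('a::euclidean_space \<Rightarrow> complex) \<Rightarrow> ('a \<Rightarrow> complex) \<Rightarrow> 'a \<Rightarrow> 'a \<Rightarrow> complex" where
  "wigner \<psi> \<phi> x p = 1 / of_real ((2 * pi) ^ DIM('a)) *
     (\<integral>y. exp (\<i> * of_real (y \<bullet> p)) * cnj (\<psi> (x + y /\<^sub>R 2)) * \<phi> (x - y /\<^sub>R 2) \<partial>lborel)"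

text \<open>The double integral in \<open>\<Theta>[V]\<close> is not absolutely convergent in \<open>(p', y)\<close>: it is iterated, first
  over \<open>p'\<close>, then over \<open>y\<close>.\<close>

definition Theta_integrand ::
  "('a::euclidean_space \<Rightarrow> real) \<Rightarrow> ('a \<Rightarrow> 'a \<Rightarrow> complex) \<Rightarrow> 'a \<Rightarrow> 'a \<Rightarrow> 'a \<Rightarrow> 'a \<Rightarrow> complex" where
  "Theta_integrand V w x p y p' =
     exp (\<i> * of_real ((p - p') \<bullet> y)) * of_real (V (x + y /\<^sub>R 2) - V (x - y /\<^sub>R 2)) * w x p'"

definition Theta ::
  "('a::euclidean_space \<Rightarrow> real) \<Rightarrow> ('a \<Rightarrow> 'a \<Rightarrow> complex) \<Rightarrow> 'a \<Rightarrow> 'a \<Rightarrow> complex" where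
  "Theta V w x p = - (\<i> / of_real ((2 * pi) ^ DIM('a))) *
     (\<integral>y. (\<integral>p'. Theta_integrand V w x p y p' \<partial>lborel) \<partial>lborel)"

text \<open>\<open>\<integral> w dp dx\<close> over phase space, first over \<open>p\<close>, then over \<open>x\<close>. Wigner transforms need not be
  absolutely integrable over phase space; with this order \<open>\<integral> w[f, g] dp dx = \<langle>f, g\<rangle>\<close> holds for
  all wave functions considered here, and for absolutely integrable \<open>w\<close> it is the usual integral by Fubini.\<close>

definition phase_integral :: "('a::euclidean_space \<Rightarrow> 'a \<Rightarrow> complex) \<Rightarrow> complex" where
  "phase_integral w = (\<integral>x. (\<integral>p. w x p \<partial>lborel) \<partial>lborel)"

definition phase_integrable :: "('a::euclidean_space \<Rightarrow> 'a \<Rightarrow> complex) \<Rightarrow> bool" where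
  "phase_integrable w \<longleftrightarrow>
     (\<forall>x. integrable lborel (w x)) \<and> integrable lborel (\<lambda>x. \<integral>p. w x p \<partial>lborel)"

text \<open>\<open>\<partial>\<^sub>t w + p \<cdot> \<nabla>\<^sub>x w + \<Theta>[V](w)\<close>, and the predicate that all derivatives and integrals in it
  exist (so that it is not made of default values).\<close>

definition transport ::
  "('a::euclidean_space \<Rightarrow> real) \<Rightarrow> (real \<Rightarrow> 'a \<Rightarrow> 'a \<Rightarrow> complex) \<Rightarrow> real \<Rightarrow> 'a \<Rightarrow> 'a \<Rightarrow> complex" where
  "transport V w t x p =
     time_deriv (\<lambda>s. w s x p) t
     + (\<Sum>b\<in>Basis. of_real (p \<bullet> b) * pdiff b (\<lambda>z. w t z p) x)
     + Theta V (w t) x p"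

definition transport_exists ::
  "('a::euclidean_space \<Rightarrow> real) \<Rightarrow> (real \<Rightarrow> 'a \<Rightarrow> 'a \<Rightarrow> complex) \<Rightarrow> real \<Rightarrow> 'a \<Rightarrow> 'a \<Rightarrow> bool" where
  "transport_exists V w t x p \<longleftrightarrow>
     (\<lambda>s. w s x p) differentiable (at t) \<and>
     (\<lambda>z. w t z p) differentiable (at x) \<and>
     (\<forall>y. integrable lborel (Theta_integrand V (w t) x p y)) \<and>
     integrable lborel (\<lambda>y. \<integral>p'. Theta_integrand V (w t) x p y p' \<partial>lborel)"

text \<open>\<open>w\<^sub>j\<^sub>k\<close> and its real and imaginary parts, the latter regarded as complex-valued so that
  \<open>\<Theta>[V]\<close> applies to them; \<open>w\<^sub>j\<close> is \<open>W \<psi> j j\<close>.\<close>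

definition W :: "(nat \<Rightarrow> real \<Rightarrow> 'a::euclidean_space \<Rightarrow> complex) \<Rightarrow> nat \<Rightarrow> nat \<Rightarrow> real \<Rightarrow> 'a \<Rightarrow> 'a \<Rightarrow> complex"
  where "W \<psi> j k t = wigner (\<psi> j t) (\<psi> k t)"

definition Wplus :: "(nat \<Rightarrow> real \<Rightarrow> 'a::euclidean_space \<Rightarrow> complex) \<Rightarrow> nat \<Rightarrow> nat \<Rightarrow> real \<Rightarrow> 'a \<Rightarrow> 'a \<Rightarrow> complex"
  where "Wplus \<psi> j k t x p = of_real (Re (W \<psi> j k t x p))"

definition Wminus :: "(nat \<Rightarrow> real \<Rightarrow> 'a::euclidean_space \<Rightarrow> complex) \<Rightarrow> nat \<Rightarrow> nat \<Rightarrow> real \<Rightarrow> 'a \<Rightarrow> 'a \<Rightarrow> complex"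
  where "Wminus \<psi> j k t x p = of_real (Im (W \<psi> j k t x p))"

end

theory Submission
  imports Defs "HOL-Probability.Probability"
begin

text \<open>Write \<open>X(a, c) = \<integral> e\<^sup>i\<^sup>y\<^sup>p cnj (f (a + y/2)) g (c - y/2) dy\<close> with two independent base points \<open>a\<close>, \<open>c\<close>, so
  that \<open>w[f, g](x, p)\<close> is \<open>X(x, x)\<close> up to the factor \<open>(2\<pi>)\<^sup>-\<^sup>d\<close>. This function (\<open>cross_wigner\<close>) is
  sesquilinear in \<open>(f, g)\<close>, and everything needed about the Wigner transform is read off from it.

  \<^item> Its derivative in \<open>(a, c)\<close> falls on \<open>f\<close> and \<open>g\<close> respectively (\<open>has_derivative_cross_wigner\<close>).
    The substitution \<open>y \<mapsto> y + v\<close> moves the base points to \<open>(a + v/2, c - v/2)\<close> at the price of a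
    phase (\<open>cross_wigner_shift\<close>); differentiating this invariance in \<open>v\<close> turns multiplication by
    \<open>p\<^sub>b\<close> into derivatives of \<open>f\<close> and \<open>g\<close> (\<open>cross_wigner_by_parts\<close>), without any boundary terms.

  \<^item> Hence \<open>p \<bullet> \<nabla>\<^sub>x w[f, g] = i/2 (w[\<Delta>f, g] - w[f, \<Delta>g])\<close> (\<open>free_transport_wigner\<close>): the mixed first order
    terms cancel. Applying \<open>cross_wigner_by_parts\<close> twice in each coordinate bounds \<open>w[f, g](x, p)\<close> by a multiple of the
    product of the \<open>1 / (1 + p\<^sub>b\<^sup>2)\<close> (\<open>cross_wigner_rapid_decay\<close>), so it is integrable in \<open>p\<close> and Fourier
    inversion (\<open>fourier_inversion\<close>) applies. Inversion gives \<open>\<integral> w[f, g] dp = cnj f g\<close>, hence \<open>\<integral> w[f, g] dp dx = \<langle>f, g\<rangle>\<close>, and it evaluates the inner integral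
    in \<open>\<Theta>[V]\<close>, so that \<open>\<Theta>[V](w[f, g]) = -i (w[V f, g] - w[f, V g])\<close> (\<open>Theta_wigner\<close>).

  \<^item> Differentiating under the integral, \<open>\<partial>\<^sub>t w[\<psi>\<^sub>j, \<psi>\<^sub>k] = w[\<partial>\<^sub>t \<psi>\<^sub>j, \<psi>\<^sub>k] + w[\<psi>\<^sub>j, \<partial>\<^sub>t \<psi>\<^sub>k]\<close>
    (\<open>has_vector_derivative_wigner\<close>). When the Schroedinger-Lohe equation is inserted, the Laplacian is
    cancelled by the free transport and the potential by \<open>\<Theta>[V]\<close>; only the coupling remains
    (\<open>transport_W\<close>):
    \<open>\<partial>\<^sub>t w\<^sub>j\<^sub>k + p \<bullet> \<nabla>\<^sub>x w\<^sub>j\<^sub>k + \<Theta>[V](w\<^sub>j\<^sub>k) = K/2N \<Sum>\<^sub>l (w\<^sub>l\<^sub>k + w\<^sub>j\<^sub>l - (\<langle>\<psi>\<^sub>j, \<psi>\<^sub>l\<rangle> + \<langle>\<psi>\<^sub>l, \<psi>\<^sub>k\<rangle>) w\<^sub>j\<^sub>k)\<close>.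

  Since \<open>cnj w\<^sub>j\<^sub>k = w\<^sub>k\<^sub>j\<close>, the real and imaginary parts of \<open>w\<^sub>j\<^sub>k\<close> are linear combinations of \<open>w\<^sub>j\<^sub>k\<close> and
  \<open>w\<^sub>k\<^sub>j\<close>, and the three equations are the corresponding combinations of this one.

  The potential is an arbitrary real function, so \<open>V \<psi>\<^sub>j\<close> has to be controlled through the equation,
  in which every other term is continuous and decays (\<open>cont_decaying_potential\<close>).\<close>

section \<open>Integrals of products, powers and Gaussians\<close>

lemma
  fixes f :: "'a::euclidean_space \<Rightarrow> real \<Rightarrow> 'c::{real_normed_field,banach,second_countable_topology}"
  assumes f: "\<And>b. b \<in> Basis \<Longrightarrow> integrable lborel (f b)"
  shows integrable_lborel_prod: "integrable lborel (\<lambda>x::'a. \<Prod>b\<in>Basis. f b (x \<bullet> b))"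
    and integral_lborel_prod:
      "(\<integral>x. (\<Prod>b\<in>Basis. f b (x \<bullet> b)) \<partial>(lborel :: 'a measure)) = (\<Prod>b\<in>Basis. \<integral>s. f b s \<partial>lborel)"
proof -
  interpret product_sigma_finite "\<lambda>_::'a. lborel :: real measure" ..
  let ?P = "\<Pi>\<^sub>M b\<in>(Basis::'a set). (lborel :: real measure)"
  let ?T = "\<lambda>g. \<Sum>b\<in>Basis. g b *\<^sub>R b :: 'a"
  have T: "?T \<in> ?P \<rightarrow>\<^sub>M borel"
    by measurable
  have [measurable]: "f b \<in> borel_measurable borel" if "b \<in> Basis" for b
    using f[OF that] by (simp add: borel_measurable_integrable)
  have m: "(\<lambda>x::'a. \<Prod>b\<in>Basis. f b (x \<bullet> b)) \<in> borel_measurable borel"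
    by measurable
  have eq: "(\<Prod>b\<in>Basis. f b (?T g \<bullet> b)) = (\<Prod>b\<in>Basis. f b (g b))" for g
    by (intro prod.cong) auto
  show "integrable lborel (\<lambda>x::'a. \<Prod>b\<in>Basis. f b (x \<bullet> b))"
    by (subst lborel_eq, subst integrable_distr_eq[OF T m], unfold eq)
       (intro product_integrable_prod f finite_Basis)
  show "(\<integral>x. (\<Prod>b\<in>Basis. f b (x \<bullet> b)) \<partial>(lborel :: 'a measure)) = (\<Prod>b\<in>Basis. \<integral>s. f b s \<partial>lborel)"
    by (subst lborel_eq, subst integral_distr[OF T m], unfold eq)
       (intro product_integral_prod f finite_Basis)
qed

lemma integrable_powr_real:
  fixes s :: real
  assumes "s > 1"
  shows "integrable lborel (\<lambda>x::real. (1 + \<bar>x\<bar>) powr (- s))"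
proof -
  define h where "h = (\<lambda>x::real. (1 + x) powr (- s) * indicator {0..} x)"
  define F where "F = (\<lambda>x::real. (1 + x) powr (1 - s) / (1 - s))"
  have nn: "(\<integral>\<^sup>+x. ennreal ((1 + x) powr (- s)) * indicator {0..} x \<partial>lborel) = ennreal (0 - F 0)"
  proof (rule nn_integral_FTC_atLeast)
    show "(F has_real_derivative (1 + x) powr (- s)) (at x)" if "0 \<le> x" for x
    proof -
      have "((\<lambda>x. (1 + x) powr (1 - s)) has_real_derivative (1 - s) * (1 + x) powr (1 - s - 1) * 1) (at x)"
        by (rule DERIV_chain2[where f="\<lambda>z. z powr (1 - s)", OF has_real_derivative_powr])
           (use that in \<open>auto intro!: derivative_eq_intros\<close>)
      from DERIV_cdivide[OF this, of "1 - s"] show ?thesis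
        using assms by (simp add: F_def)
    qed
    show "(F \<longlongrightarrow> 0) at_top"
      unfolding F_def using assms by real_asymp
  qed auto
  have h: "integrable lborel h"
    unfolding h_def
  proof (rule integrableI_nonneg)
    have "(\<integral>\<^sup>+x. ennreal ((1 + x) powr (- s) * indicator {0..} x) \<partial>lborel) = ennreal (0 - F 0)"
      unfolding nn[symmetric] by (intro nn_integral_cong) (auto split: split_indicator)
    then show "(\<integral>\<^sup>+x. ennreal ((1 + x) powr (- s) * indicator {0..} x) \<partial>lborel) < \<infinity>"
      by simp
  qed (auto split: split_indicator)
  have h': "integrable lborel (\<lambda>x. h (- x))"
    using lborel_integrable_real_affine[OF h, of "-1" 0] by simp
  show ?thesis
    by (rule Bochner_Integration.integrable_bound[OF Bochner_Integration.integrable_add[OF h h']])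
       (auto simp: h_def split: split_indicator)
qed

text \<open>By \<open>1 + \<bar>x\<^sub>b\<bar> \<le> 1 + norm x\<close> for each of the \<open>d\<close> coordinates, the integrand is at most the product of the
  one-dimensional weights with exponent \<open>m/d > 1\<close>.\<close>

lemma integrable_powr_norm:
  fixes m :: real
  assumes "m > DIM('a::euclidean_space)"
  shows "integrable lborel (\<lambda>x::'a. (1 + norm x) powr (- m))"
proof -
  let ?d = "real DIM('a)"
  have d: "?d > 0" by simp
  let ?g = "\<lambda>x::'a. \<Prod>b\<in>Basis. (1 + \<bar>x \<bullet> b\<bar>) powr (- (m / ?d))"
  have "integrable lborel ?g"
    by (rule integrable_lborel_prod, rule integrable_powr_real) (use assms d in \<open>simp add: field_simps\<close>)
  then show ?thesis
  proof (rule Bochner_Integration.integrable_bound)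
    show "AE x in lborel. norm ((1 + norm x) powr (- m)) \<le> norm (?g x)"
    proof (rule AE_I2)
      fix x :: 'a
      have pos: "1 + norm x > 0" "1 + norm x \<noteq> 0"
        by (simp_all add: add_pos_nonneg add_nonneg_eq_0_iff)
      have "(1 + norm x) powr (- m) = (\<Prod>b\<in>(Basis::'a set). (1 + norm x) powr (- (m / ?d)))"
        using pos by (simp add: powr_realpow[symmetric] powr_powr)
      also have "\<dots> \<le> ?g x"
        using assms d
        by (intro prod_mono conjI powr_mono2') (auto intro: Basis_le_norm)
      finally show "norm ((1 + norm x) powr (- m)) \<le> norm (?g x)"
        by (simp add: prod_nonneg)
    qed
  qed measurable
qed

lemma
  shows integrable_gauss_char: "integrable lborel (\<lambda>s::real. exp (\<i> * of_real (t * s)) * of_real (exp (- s\<^sup>2 / 2)))"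
    and integral_gauss_char: "(\<integral>s. exp (\<i> * of_real (t * s)) * of_real (exp (- s\<^sup>2 / 2)) \<partial>lborel)
      = of_real (sqrt (2 * pi) * exp (- t\<^sup>2 / 2))"
proof -
  have g: "exp (- s\<^sup>2 / 2) = sqrt (2 * pi) * std_normal_density s" for s :: real
    by (simp add: std_normal_density_def)
  have i: "integrable lborel (\<lambda>s::real. exp (- s\<^sup>2 / 2))"
    unfolding g by (intro integrable_mult_right integrable_normal_density) simp
  show "integrable lborel (\<lambda>s::real. exp (\<i> * of_real (t * s)) * of_real (exp (- s\<^sup>2 / 2)))"
    by (rule Bochner_Integration.integrable_bound[OF i]) (auto simp: norm_mult)
  have "of_real (exp (- t\<^sup>2 / 2)) = (CLINT s|std_normal_distribution. iexp (t * s))"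
    using char_std_normal_distribution unfolding char_def by metis
  also have "\<dots> = (\<integral>s. std_normal_density s *\<^sub>R iexp (t * s) \<partial>lborel)"
    by (subst integral_density) (auto simp: normal_density_nonneg)
  finally have "of_real (sqrt (2 * pi)) * of_real (exp (- t\<^sup>2 / 2))
     = of_real (sqrt (2 * pi)) * (\<integral>s. std_normal_density s *\<^sub>R iexp (t * s) \<partial>lborel)"
    by (simp only:)
  also have "\<dots> = (\<integral>s. of_real (sqrt (2 * pi)) * (std_normal_density s *\<^sub>R iexp (t * s)) \<partial>lborel)"
    by (rule integral_mult_right_zero[symmetric])
  also have "\<dots> = (\<integral>s. exp (\<i> * of_real (t * s)) * of_real (exp (- s\<^sup>2 / 2)) \<partial>lborel)"
    unfolding g by (intro Bochner_Integration.integral_cong) (auto simp: scaleR_conv_of_real)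
  finally show "(\<integral>s. exp (\<i> * of_real (t * s)) * of_real (exp (- s\<^sup>2 / 2)) \<partial>lborel)
      = of_real (sqrt (2 * pi) * exp (- t\<^sup>2 / 2))" by simp
qed

lemma
  fixes u :: "'a::euclidean_space"
  shows integrable_gauss_char_euclidean:
     "integrable lborel (\<lambda>p::'a. exp (\<i> * of_real (u \<bullet> p)) * of_real (exp (- (norm p)\<^sup>2 / 2)))"
    and integral_gauss_char_euclidean:
     "(\<integral>p. exp (\<i> * of_real (u \<bullet> p)) * of_real (exp (- (norm p)\<^sup>2 / 2)) \<partial>lborel)
      = of_real (sqrt (2 * pi) ^ DIM('a) * exp (- (norm u)\<^sup>2 / 2))"
proof -
  have n: "(norm p)\<^sup>2 = (\<Sum>b\<in>Basis. (p \<bullet> b)\<^sup>2)" for p :: 'a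
    unfolding power2_norm_eq_inner by (subst euclidean_inner) (simp add: power2_eq_square)
  have e: "exp (- (norm p)\<^sup>2 / 2) = (\<Prod>b\<in>Basis. exp (- (p \<bullet> b)\<^sup>2 / 2))" for p :: 'a
    unfolding n by (simp add: exp_sum sum_negf[symmetric] sum_divide_distrib)
  have "exp (\<i> * of_real (u \<bullet> p)) = (\<Prod>b\<in>Basis. exp (\<i> * of_real ((u \<bullet> b) * (p \<bullet> b))))" for p
    by (subst euclidean_inner) (simp add: exp_sum sum_distrib_left)
  then have eq: "exp (\<i> * of_real (u \<bullet> p)) * of_real (exp (- (norm p)\<^sup>2 / 2))
    = (\<Prod>b\<in>Basis. exp (\<i> * of_real ((u \<bullet> b) * (p \<bullet> b))) * of_real (exp (- (p \<bullet> b)\<^sup>2 / 2)))" for p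
    unfolding e by (simp add: prod.distrib)
  show "integrable lborel (\<lambda>p::'a. exp (\<i> * of_real (u \<bullet> p)) * of_real (exp (- (norm p)\<^sup>2 / 2)))"
    unfolding eq by (rule integrable_lborel_prod integrable_gauss_char)+
  show "(\<integral>p. exp (\<i> * of_real (u \<bullet> p)) * of_real (exp (- (norm p)\<^sup>2 / 2)) \<partial>lborel)
      = of_real (sqrt (2 * pi) ^ DIM('a) * exp (- (norm u)\<^sup>2 / 2))"
    unfolding eq
    by (subst integral_lborel_prod[OF integrable_gauss_char], unfold integral_gauss_char e[of u])
       (simp add: prod.distrib)
qed

lemma lborel_integral_affine:
  fixes f :: "'a::euclidean_space \<Rightarrow> 'b::{banach, second_countable_topology}"
  assumes c: "c \<noteq> 0" and [measurable]: "f \<in> borel_measurable borel"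
  shows "(\<integral>x. f x \<partial>lborel) = (\<bar>c\<bar> ^ DIM('a)) *\<^sub>R (\<integral>x. f (t + c *\<^sub>R x) \<partial>lborel)"
  by (subst lborel_affine[OF c, of t]) (simp add: integral_density integral_distr)

lemma lborel_integrable_affine:
  fixes f :: "'a::euclidean_space \<Rightarrow> 'b::{banach, second_countable_topology}"
  assumes c: "c \<noteq> 0" and f: "integrable lborel f"
  shows "integrable lborel (\<lambda>x. f (t + c *\<^sub>R x))"
proof -
  have [measurable]: "f \<in> borel_measurable borel" using f by simp
  have "integrable (density (distr lborel borel (\<lambda>x. t + c *\<^sub>R x)) (\<lambda>_. \<bar>c\<bar>^DIM('a))) f"
    using f lborel_affine[OF c, of t] by simp
  then have "integrable lborel (\<lambda>x. \<bar>c\<bar> ^ DIM('a) *\<^sub>R f (t + c *\<^sub>R x))"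
    by (subst (asm) integrable_density) (simp_all add: integrable_distr_eq)
  from integrable_scaleR_right[OF this, of "inverse (\<bar>c\<bar> ^ DIM('a))"] show ?thesis
    using c by simp
qed

section \<open>Fourier inversion\<close>

text \<open>The transform \<open>F\<close> is multiplied by the Gaussian \<open>exp (- \<epsilon>\<^sup>2 norm p\<^sup>2 / 2)\<close>, so that Fubini applies. As the
  Gaussian is its own Fourier transform up to a factor, the regularised integral is an average of \<open>h\<close> over a
  Gaussian of width \<open>\<epsilon>\<close> around \<open>y\<close>; both sides converge as \<open>\<epsilon> \<rightarrow> 0\<close>. The constant \<open>(2\<pi>)\<^sup>d\<close> arises as
  \<open>\<surd>(2\<pi>)\<^sup>d\<close> once from the transform of the Gaussian and once from its mass.\<close>

lemma fourier_inversion: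
  fixes h :: "'a::euclidean_space \<Rightarrow> complex" and y :: 'a
  defines "F \<equiv> \<lambda>p. \<integral>z. exp (\<i> * of_real (z \<bullet> p)) * h z \<partial>lborel"
  assumes cont: "continuous_on UNIV h" and bdd: "\<And>z. norm (h z) \<le> B"
    and h: "integrable lborel h" and F: "integrable lborel F"
  shows "(\<integral>p. exp (- (\<i> * of_real (y \<bullet> p))) * F p \<partial>lborel) = of_real ((2 * pi) ^ DIM('a)) * h y"
proof -
  let ?d = "DIM('a)"
  let ?g = "\<lambda>p::'a. complex_of_real (exp (- (norm p)\<^sup>2 / 2))"
  let ?c = "complex_of_real (sqrt (2 * pi) ^ ?d)"
  have [measurable]: "h \<in> borel_measurable borel"
    using h by simp
  have [measurable]: "F \<in> borel_measurable borel"
    using F by simp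
  define I where "I = (\<lambda>e::real. \<integral>p. exp (- (\<i> * of_real (y \<bullet> p))) * F p * ?g (e *\<^sub>R p) \<partial>lborel)"
  have g_int: "integrable lborel ?g"
    using integrable_gauss_char_euclidean[of "0::'a"] by simp
  have g_val: "(\<integral>p. ?g p \<partial>lborel) = ?c"
    using integral_gauss_char_euclidean[of "0::'a"] by simp
  \<comment> \<open>Fubini and the substitutions \<open>z = y + \<epsilon> u\<close>, \<open>q = \<epsilon> p\<close>, whose factors \<open>\<epsilon>\<^sup>d\<close> cancel.\<close>
  have I_eq: "I e = ?c * (\<integral>u. h (y + e *\<^sub>R u) * ?g u \<partial>lborel)" if e: "e > 0" for e :: real
  proof -
    define G where "G = (\<lambda>(p::'a, z::'a). exp (\<i> * of_real ((z - y) \<bullet> p)) * h z * ?g (e *\<^sub>R p))"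
    have [measurable]: "G \<in> borel_measurable (lborel \<Otimes>\<^sub>M lborel)"
      unfolding G_def by measurable
    have ge: "integrable lborel (\<lambda>p. ?g (e *\<^sub>R p))"
      using lborel_integrable_affine[OF _ g_int, of e 0] e by simp
    have Gint: "integrable (lborel \<Otimes>\<^sub>M lborel) G"
    proof (rule lborel_pair.Fubini_integrable)
      have "(\<integral>z. norm (G (p, z)) \<partial>lborel) = (\<integral>z. norm (h z) \<partial>lborel) * norm (?g (e *\<^sub>R p))" for p
        by (simp add: G_def norm_mult)
      then show "integrable lborel (\<lambda>p. \<integral>z. norm (G (p, z)) \<partial>lborel)"
        using integrable_norm[OF ge] by simp
      show "AE p in lborel. integrable lborel (\<lambda>z. G (p, z))"
      proof (rule AE_I2)
        fix p :: 'a
        have "integrable lborel (\<lambda>z. exp (\<i> * of_real ((z - y) \<bullet> p)) * h z)"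
          by (rule Bochner_Integration.integrable_bound[OF h]) (auto simp: norm_mult)
        then show "integrable lborel (\<lambda>z. G (p, z))"
          by (simp add: G_def)
      qed
    qed measurable
    have "I e = (\<integral>p. \<integral>z. G (p, z) \<partial>lborel \<partial>lborel)"
      unfolding I_def
    proof (rule Bochner_Integration.integral_cong[OF refl])
      fix p :: 'a
      have "exp (- (\<i> * of_real (y \<bullet> p))) * F p
        = (\<integral>z. exp (- (\<i> * of_real (y \<bullet> p))) * (exp (\<i> * of_real (z \<bullet> p)) * h z) \<partial>lborel)"
        unfolding F_def by (rule integral_mult_right_zero[symmetric])
      also have "\<dots> = (\<integral>z. exp (\<i> * of_real ((z - y) \<bullet> p)) * h z \<partial>lborel)"
      proof (rule Bochner_Integration.integral_cong[OF refl])
        fix z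
        have "exp (\<i> * of_real ((z - y) \<bullet> p)) = exp (- (\<i> * of_real (y \<bullet> p))) * exp (\<i> * of_real (z \<bullet> p))"
          unfolding exp_add[symmetric] by (simp add: inner_diff_left right_diff_distrib)
        then show "exp (- (\<i> * of_real (y \<bullet> p))) * (exp (\<i> * of_real (z \<bullet> p)) * h z)
          = exp (\<i> * of_real ((z - y) \<bullet> p)) * h z"
          by (simp only: mult.assoc)
      qed
      finally show "exp (- (\<i> * of_real (y \<bullet> p))) * F p * ?g (e *\<^sub>R p) = (\<integral>z. G (p, z) \<partial>lborel)"
        by (simp add: G_def)
    qed
    also have "\<dots> = (\<integral>z. \<integral>p. G (p, z) \<partial>lborel \<partial>lborel)"
      by (rule lborel_pair.Fubini_integral[symmetric]) (use Gint in simp)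
    also have "\<dots> = e ^ ?d *\<^sub>R (\<integral>u. \<integral>p. G (p, y + e *\<^sub>R u) \<partial>lborel \<partial>lborel)"
      by (subst lborel_integral_affine[where c=e and t=y]) (use e in \<open>simp_all add: G_def\<close>)
    also have "\<dots> = (\<integral>u. e ^ ?d *\<^sub>R (\<integral>p. G (p, y + e *\<^sub>R u) \<partial>lborel) \<partial>lborel)"
      by simp
    also have "\<dots> = (\<integral>u. ?c * (h (y + e *\<^sub>R u) * ?g u) \<partial>lborel)"
    proof (rule Bochner_Integration.integral_cong[OF refl])
      fix u :: 'a
      have "e ^ ?d *\<^sub>R (\<integral>p. G (p, y + e *\<^sub>R u) \<partial>lborel)
        = h (y + e *\<^sub>R u) * (\<bar>e\<bar> ^ ?d *\<^sub>R
            (\<integral>p. exp (\<i> * of_real (u \<bullet> (0 + e *\<^sub>R p))) * ?g (0 + e *\<^sub>R p) \<partial>lborel))"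
        using e by (simp add: G_def algebra_simps)
      also have "\<dots> = h (y + e *\<^sub>R u) * (\<integral>q. exp (\<i> * of_real (u \<bullet> q)) * ?g q \<partial>lborel)"
        by (subst lborel_integral_affine[symmetric]) (use e in auto)
      also have "\<dots> = ?c * (h (y + e *\<^sub>R u) * ?g u)"
        unfolding integral_gauss_char_euclidean by simp
      finally show "e ^ ?d *\<^sub>R (\<integral>p. G (p, y + e *\<^sub>R u) \<partial>lborel) = ?c * (h (y + e *\<^sub>R u) * ?g u)" .
    qed
    finally show ?thesis
      by simp
  qed
  define e where "e = (\<lambda>n. inverse (real (Suc n)))"
  have e: "e \<longlonglongrightarrow> 0" "\<And>n. e n > 0"
    unfolding e_def using LIMSEQ_inverse_real_of_nat by auto
  have "(\<lambda>n. I (e n)) \<longlonglongrightarrow> (\<integral>p. exp (- (\<i> * of_real (y \<bullet> p))) * F p * ?g 0 \<partial>lborel)"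
    unfolding I_def
  proof (rule integral_dominated_convergence)
    show "integrable lborel (\<lambda>p. norm (F p))"
      using F by simp
    show "AE p in lborel. (\<lambda>n. exp (- (\<i> * of_real (y \<bullet> p))) * F p * ?g (e n *\<^sub>R p)) \<longlonglongrightarrow>
        exp (- (\<i> * of_real (y \<bullet> p))) * F p * ?g 0"
    proof (rule AE_I2)
      fix p :: 'a
      have "(\<lambda>n. e n *\<^sub>R p) \<longlonglongrightarrow> 0 *\<^sub>R p"
        by (intro tendsto_intros e)
      then have "(\<lambda>n. ?g (e n *\<^sub>R p)) \<longlonglongrightarrow> ?g 0"
        by (intro tendsto_intros) simp_all
      then show "(\<lambda>n. exp (- (\<i> * of_real (y \<bullet> p))) * F p * ?g (e n *\<^sub>R p)) \<longlonglongrightarrow>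
        exp (- (\<i> * of_real (y \<bullet> p))) * F p * ?g 0"
        by (rule tendsto_mult_left)
    qed
    show "AE p in lborel. norm (exp (- (\<i> * of_real (y \<bullet> p))) * F p * ?g (e n *\<^sub>R p)) \<le> norm (F p)" for n
      by (rule AE_I2) (auto simp: norm_mult intro!: mult_left_le)
  qed measurable
  moreover have "(\<lambda>n. I (e n)) \<longlonglongrightarrow> ?c * (\<integral>u. h y * ?g u \<partial>lborel)"
    unfolding I_eq[OF e(2)]
  proof (intro tendsto_mult_left, rule integral_dominated_convergence)
    show "integrable lborel (\<lambda>u. B * norm (?g u))"
      using integrable_norm[OF g_int] by simp
    show "AE u in lborel. (\<lambda>n. h (y + e n *\<^sub>R u) * ?g u) \<longlonglongrightarrow> h y * ?g u"
    proof (rule AE_I2)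
      fix u :: 'a
      have "(\<lambda>n. y + e n *\<^sub>R u) \<longlonglongrightarrow> y + 0 *\<^sub>R u"
        by (intro tendsto_intros e)
      then have "(\<lambda>n. h (y + e n *\<^sub>R u)) \<longlonglongrightarrow> h y"
        using cont by (intro continuous_on_tendsto_compose[OF cont]) auto
      then show "(\<lambda>n. h (y + e n *\<^sub>R u) * ?g u) \<longlonglongrightarrow> h y * ?g u"
        by (rule tendsto_mult_right)
    qed
    show "AE u in lborel. norm (h (y + e n *\<^sub>R u) * ?g u) \<le> B * norm (?g u)" for n
      by (rule AE_I2) (auto simp: norm_mult intro!: mult_right_mono bdd)
  qed measurable
  ultimately have "(\<integral>p. exp (- (\<i> * of_real (y \<bullet> p))) * F p * ?g 0 \<partial>lborel) = ?c * (\<integral>u. h y * ?g u \<partial>lborel)"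
    by (rule LIMSEQ_unique)
  also have "\<dots> = (?c * ?c) * h y"
    by (simp only: integral_mult_right_zero g_val) simp
  also have "?c * ?c = of_real ((2 * pi) ^ ?d)"
  proof -
    have "sqrt (2 * pi) ^ ?d * sqrt (2 * pi) ^ ?d = (sqrt (2 * pi) * sqrt (2 * pi)) ^ ?d"
      by (rule power_mult_distrib[symmetric])
    also have "sqrt (2 * pi) * sqrt (2 * pi) = 2 * pi"
      by (simp add: real_sqrt_mult_self)
    finally show ?thesis
      by (simp only: of_real_mult[symmetric])
  qed
  finally show ?thesis by simp
qed

section \<open>Differentiation under the integral sign\<close>

text \<open>The difference quotients converge pointwise and, by the mean value inequality on the ball, are dominated
  by \<open>2 g\<close>.\<close>

lemma has_derivative_integral_dominated:
  fixes f :: "'e::euclidean_space \<Rightarrow> 'b \<Rightarrow> 'c::{banach, second_countable_topology}"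
  assumes r: "r > 0"
    and f: "\<And>x. x \<in> ball x0 r \<Longrightarrow> integrable M (f x)"
    and f': "\<And>h. f' x0 h \<in> borel_measurable M"
    and D: "\<And>x y. x \<in> ball x0 r \<Longrightarrow> ((\<lambda>x. f x y) has_derivative (\<lambda>h. f' x h y)) (at x)"
    and bound: "\<And>x y h. x \<in> ball x0 r \<Longrightarrow> norm (f' x h y) \<le> g y * norm h"
    and g: "integrable M g"
  shows "((\<lambda>x. \<integral>y. f x y \<partial>M) has_derivative (\<lambda>h. \<integral>y. f' x0 h y \<partial>M)) (at x0)"
proof -
  have x0: "x0 \<in> ball x0 r" using r by simp
  have gn: "g y \<ge> 0" for y
  proof -
    obtain b :: 'e where b: "b \<in> Basis" by (meson SOME_Basis)
    have "0 \<le> norm (f' x0 b y)" by simp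
    also have "\<dots> \<le> g y" using bound[OF x0, of b y] b by simp
    finally show ?thesis .
  qed
  have i: "integrable M (f' x0 h)" for h
  proof (rule Bochner_Integration.integrable_bound[OF integrable_mult_left[OF g, of "norm h"]])
    show "AE y in M. norm (f' x0 h y) \<le> norm (g y * norm h)"
      using bound[OF x0] gn by auto
  qed (rule f')
  have lin: "bounded_linear (\<lambda>h. f' x0 h y)" for y
    using D[OF x0] by (rule has_derivative_bounded_linear)
  have bl: "bounded_linear (\<lambda>h. \<integral>y. f' x0 h y \<partial>M)"
  proof (rule bounded_linear_intro)
    show "(\<integral>y. f' x0 (u + v) y \<partial>M) = (\<integral>y. f' x0 u y \<partial>M) + (\<integral>y. f' x0 v y \<partial>M)" for u v
      using linear_add[OF bounded_linear.linear[OF lin]] i by simp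
    show "(\<integral>y. f' x0 (c *\<^sub>R u) y \<partial>M) = c *\<^sub>R (\<integral>y. f' x0 u y \<partial>M)" for c u
      using linear_scale[OF bounded_linear.linear[OF lin]] by simp
    show "norm (\<integral>y. f' x0 h y \<partial>M) \<le> norm h * (\<integral>y. g y \<partial>M)" for h
    proof -
      have "norm (\<integral>y. f' x0 h y \<partial>M) \<le> (\<integral>y. norm (f' x0 h y) \<partial>M)"
        by (rule integral_norm_bound)
      also have "\<dots> \<le> (\<integral>y. g y * norm h \<partial>M)"
        using i g bound[OF x0] by (intro integral_mono) auto
      finally show ?thesis by (simp add: mult.commute)
    qed
  qed
  let ?Q = "\<lambda>x y. (f x y - f x0 y - f' x0 (x - x0) y) /\<^sub>R norm (x - x0)"
  have Qint: "(\<integral>y. ?Q x y \<partial>M)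
      = ((\<integral>y. f x y \<partial>M) - (\<integral>y. f x0 y \<partial>M) - (\<integral>y. f' x0 (x - x0) y \<partial>M)) /\<^sub>R norm (x - x0)"
    if "x \<in> ball x0 r" for x
    using f[OF that] f[OF x0] i by simp
  have "((\<lambda>x. \<integral>y. ?Q x y \<partial>M) \<longlongrightarrow> 0) (at x0)"
    unfolding tendsto_at_iff_sequentially comp_def
  proof (intro allI impI)
    fix X :: "nat \<Rightarrow> 'e"
    assume X: "\<forall>i. X i \<in> UNIV - {x0}" "X \<longlonglongrightarrow> x0"
    have "\<forall>\<^sub>F n in sequentially. X n \<in> ball x0 r"
      by (rule topological_tendstoD[OF X(2) open_ball x0])
    then obtain n0 where n0: "\<And>n. n \<ge> n0 \<Longrightarrow> X n \<in> ball x0 r"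
      by (auto simp: eventually_sequentially)
    define Y where "Y = (\<lambda>n. X (n + n0))"
    have Y: "Y n \<in> ball x0 r" "Y n \<noteq> x0" for n
      using n0 X(1) by (auto simp: Y_def)
    have Ylim: "Y \<longlonglongrightarrow> x0"
      unfolding Y_def using X(2) by (rule LIMSEQ_ignore_initial_segment)
    have "(\<lambda>n. \<integral>y. ?Q (Y n) y \<partial>M) \<longlonglongrightarrow> (\<integral>y. 0 \<partial>M)"
    proof (rule integral_dominated_convergence)
      show "(\<lambda>y. ?Q (Y n) y) \<in> borel_measurable M" for n
        using f[OF Y(1)[of n]] f[OF x0] i by (intro borel_measurable_integrable) simp
      show "integrable M (\<lambda>y. 2 * g y)" using g by simp
      show "AE y in M. (\<lambda>n. ?Q (Y n) y) \<longlonglongrightarrow> 0"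
      proof (rule AE_I2)
        fix y
        have "((\<lambda>x. ?Q x y) \<longlongrightarrow> 0) (at x0)"
          using D[OF x0, of y] unfolding has_derivative_at_within by simp
        then show "(\<lambda>n. ?Q (Y n) y) \<longlonglongrightarrow> 0"
          unfolding tendsto_at_iff_sequentially comp_def using Y Ylim by auto
      qed
      show "AE y in M. norm (?Q (Y n) y) \<le> 2 * g y" for n
      proof (rule AE_I2)
        fix y
        have "norm (f (Y n) y - f x0 y) \<le> g y * norm (Y n - x0)"
        proof (rule differentiable_bound[OF convex_ball])
          show "((\<lambda>x. f x y) has_derivative (\<lambda>h. f' x h y)) (at x within ball x0 r)"
            if "x \<in> ball x0 r" for x
            using D[OF that] by (rule has_derivative_at_withinI)
          show "onorm (\<lambda>h. f' x h y) \<le> g y" if "x \<in> ball x0 r" for x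
            using bound[OF that] by (intro onorm_le)
        qed (use Y x0 in auto)
        moreover have "norm (f' x0 (Y n - x0) y) \<le> g y * norm (Y n - x0)"
          by (rule bound[OF x0])
        ultimately have "norm (f (Y n) y - f x0 y - f' x0 (Y n - x0) y) \<le> 2 * g y * norm (Y n - x0)"
          by (rule order_trans[OF norm_triangle_ineq4 order_trans[OF add_mono]]) simp
        moreover have "norm (?Q (Y n) y) = norm (f (Y n) y - f x0 y - f' x0 (Y n - x0) y) / norm (Y n - x0)"
          unfolding norm_scaleR by (simp add: divide_inverse mult.commute)
        ultimately show "norm (?Q (Y n) y) \<le> 2 * g y"
          using Y(2)[of n] by (simp add: pos_divide_le_eq)
      qed
    qed simp
    then show "(\<lambda>n. \<integral>y. ?Q (X n) y \<partial>M) \<longlonglongrightarrow> 0"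
      unfolding Y_def by (auto intro: LIMSEQ_offset)
  qed
  then have "((\<lambda>x. ((\<integral>y. f x y \<partial>M) - (\<integral>y. f x0 y \<partial>M) - (\<integral>y. f' x0 (x - x0) y \<partial>M)) /\<^sub>R norm (x - x0)) \<longlongrightarrow> 0) (at x0)"
    by (rule Lim_transform_within_open[OF _ open_ball x0]) (erule Qint)
  then show ?thesis
    unfolding has_derivative_at_within using bl by simp
qed

section \<open>Decaying functions\<close>

text \<open>The exponent exceeds half the dimension, so that the product of two such functions is
  integrable.\<close>

definition decaying :: "('a::euclidean_space \<Rightarrow> complex) \<Rightarrow> bool" where
  "decaying f \<longleftrightarrow> (\<exists>m C. m > real DIM('a) / 2 \<and> (\<forall>x. norm (f x) \<le> C * (1 + norm x) powr (- m)))"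

lemma decayingI:
  fixes f :: "'a::euclidean_space \<Rightarrow> complex"
  assumes "m > real DIM('a) / 2" "\<And>x. norm (f x) \<le> C * (1 + norm x) powr (- m)"
  shows "decaying f"
  using assms unfolding decaying_def by blast

lemma decayingE:
  fixes f :: "'a::euclidean_space \<Rightarrow> complex"
  assumes "decaying f"
  obtains m C where "m > real DIM('a) / 2" "C \<ge> 0" "\<And>x. norm (f x) \<le> C * (1 + norm x) powr (- m)"
proof -
  obtain m C where *: "m > real DIM('a) / 2" "\<And>x. norm (f x) \<le> C * (1 + norm x) powr (- m)"
    using assms unfolding decaying_def by blast
  have "C \<ge> 0"
    using order_trans[OF norm_ge_zero *(2)[of 0]] by simp
  with * that show ?thesis by blast
qed

lemma decaying_mono:
  assumes "decaying g" "\<And>x. norm (f x) \<le> norm (g x)"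
  shows "decaying f"
  using assms unfolding decaying_def by (meson order_trans)

lemma decaying_add:
  fixes f g :: "'a::euclidean_space \<Rightarrow> complex"
  assumes "decaying f" "decaying g"
  shows "decaying (\<lambda>x. f x + g x)"
proof -
  obtain m C where f: "m > real DIM('a) / 2" "C \<ge> 0" "\<And>x. norm (f x) \<le> C * (1 + norm x) powr (- m)"
    using decayingE[OF assms(1)] by blast
  obtain n D where g: "n > real DIM('a) / 2" "D \<ge> 0" "\<And>x. norm (g x) \<le> D * (1 + norm x) powr (- n)"
    using decayingE[OF assms(2)] by blast
  show ?thesis
  proof (rule decayingI)
    show "min m n > real DIM('a) / 2" using f g by simp
    fix x
    have "norm (f x + g x) \<le> C * (1 + norm x) powr (- m) + D * (1 + norm x) powr (- n)"
      by (intro norm_triangle_le add_mono f g)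
    also have "\<dots> \<le> C * (1 + norm x) powr (- min m n) + D * (1 + norm x) powr (- min m n)"
      by (intro add_mono mult_left_mono powr_mono f g) auto
    finally show "norm (f x + g x) \<le> (C + D) * (1 + norm x) powr (- min m n)"
      by (simp add: algebra_simps)
  qed
qed

lemma decaying_cmult:
  assumes "decaying f" shows "decaying (\<lambda>x. c * f x)"
proof -
  obtain m C where f: "m > real DIM('a) / 2" "C \<ge> 0" "\<And>x. norm (f x) \<le> C * (1 + norm x) powr (- m)"
    using decayingE[OF assms] by blast
  show ?thesis
  proof (rule decayingI)
    fix x show "norm (c * f x) \<le> (norm c * C) * (1 + norm x) powr (- m)"
      unfolding norm_mult mult.assoc by (intro mult_left_mono f) simp
  qed (rule f)
qed

lemma decaying_zero: "decaying (\<lambda>_::'a::euclidean_space. 0)"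
  by (rule decayingI[where m="real DIM('a)" and C=0]) auto

lemma decaying_sum:
  assumes "\<And>i. i \<in> A \<Longrightarrow> decaying (f i)"
  shows "decaying (\<lambda>x. \<Sum>i\<in>A. f i x)"
  using assms
proof (induction A rule: infinite_finite_induct)
  case (insert i A)
  then show ?case by (simp add: decaying_add)
qed (simp_all add: decaying_zero)

definition cont_decaying :: "('a::euclidean_space \<Rightarrow> complex) \<Rightarrow> bool" where
  "cont_decaying f \<longleftrightarrow> continuous_on UNIV f \<and> decaying f"

lemma cont_decaying_add:
  "cont_decaying f \<Longrightarrow> cont_decaying g \<Longrightarrow> cont_decaying (\<lambda>x. f x + g x)"
  unfolding cont_decaying_def by (auto intro: decaying_add continuous_intros)

lemma cont_decaying_cmult: "cont_decaying f \<Longrightarrow> cont_decaying (\<lambda>x. c * f x)"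
  unfolding cont_decaying_def by (auto intro: decaying_cmult continuous_intros)

lemma cont_decaying_diff:
  "cont_decaying f \<Longrightarrow> cont_decaying g \<Longrightarrow> cont_decaying (\<lambda>x. f x - g x)"
  using cont_decaying_add[of f "\<lambda>x. (-1) * g x"] cont_decaying_cmult[of g "-1"] by simp

lemma cont_decaying_sum:
  "(\<And>i. i \<in> A \<Longrightarrow> cont_decaying (f i)) \<Longrightarrow> cont_decaying (\<lambda>x. \<Sum>i\<in>A. f i x)"
  unfolding cont_decaying_def by (auto intro!: decaying_sum continuous_intros)

text \<open>Bounded shifts of the base point cost only a constant, which makes the bounds on Wigner integrands
  locally uniform in \<open>x\<close>.\<close>

lemma weight_shift:
  fixes a y :: "'a::euclidean_space"
  assumes "m \<ge> 0" "norm a \<le> R"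
  shows "(1 + norm (a + y /\<^sub>R 2)) powr (- m) \<le> (2 * (1 + R)) powr m * (1 + norm y) powr (- m)"
proof -
  have R: "R \<ge> 0" using assms(2) norm_ge_zero order_trans by blast
  have "norm y / 2 = norm ((a + y /\<^sub>R 2) - a)"
    by simp
  also have "\<dots> \<le> norm (a + y /\<^sub>R 2) + R"
    using norm_triangle_ineq4[of "a + y /\<^sub>R 2" a] assms(2) by simp
  finally have "1 + norm y \<le> 2 * (1 + R) + 2 * norm (a + y /\<^sub>R 2)"
    using R by simp
  also have "\<dots> \<le> (2 * (1 + R)) * (1 + norm (a + y /\<^sub>R 2))"
    using R by (simp add: algebra_simps)
  finally have *: "1 + norm y \<le> (2 * (1 + R)) * (1 + norm (a + y /\<^sub>R 2))" .
  have "(1 + norm y) powr m \<le> ((2 * (1 + R)) * (1 + norm (a + y /\<^sub>R 2))) powr m"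
    by (rule powr_mono2[OF assms(1) _ *]) simp
  also have "\<dots> = (2 * (1 + R)) powr m * (1 + norm (a + y /\<^sub>R 2)) powr m"
    by (rule powr_mult)
  finally have **: "(1 + norm y) powr m \<le> (2 * (1 + R)) powr m * (1 + norm (a + y /\<^sub>R 2)) powr m" .
  have pos: "(1 + norm y) powr m > 0" "(1 + norm (a + y /\<^sub>R 2)) powr m > 0"
    by (simp_all add: add_nonneg_eq_0_iff)
  show ?thesis
    using ** pos by (simp add: powr_minus field_simps)
qed

lemma ex_dominating:
  fixes m n :: real
  assumes m: "m > real DIM('a::euclidean_space) / 2" and n: "n > real DIM('a) / 2"
  obtains G :: "'a::euclidean_space \<Rightarrow> real" where "integrable lborel G"
    "\<And>a c y. norm a \<le> R \<Longrightarrow> norm c \<le> R \<Longrightarrow>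
      (1 + norm (a + y /\<^sub>R 2)) powr (- m) * (1 + norm (c - y /\<^sub>R 2)) powr (- n) \<le> G y"
proof
  let ?K = "(2 * (1 + R)) powr m * (2 * (1 + R)) powr n"
  have m0: "m \<ge> 0" "n \<ge> 0"
    using m n by (meson divide_nonneg_pos less_eq_real_def of_nat_0_le_iff order_trans zero_less_numeral)+
  show "integrable lborel (\<lambda>y::'a. ?K * (1 + norm y) powr (- (m + n)))"
    using m n by (intro integrable_mult_right integrable_powr_norm) simp
  fix a c y :: 'a
  assume a: "norm a \<le> R" and c: "norm c \<le> R"
  have "(1 + norm (a + y /\<^sub>R 2)) powr (- m) * (1 + norm (c - y /\<^sub>R 2)) powr (- n)
    \<le> ((2 * (1 + R)) powr m * (1 + norm y) powr (- m)) * ((2 * (1 + R)) powr n * (1 + norm y) powr (- n))"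
    using weight_shift[OF m0(1) a, of y] weight_shift[OF m0(2) c, of "- y"]
    by (intro mult_mono) auto
  also have "\<dots> = ?K * (1 + norm y) powr (- (m + n))"
    by (simp add: powr_add[symmetric] algebra_simps)
  finally show "(1 + norm (a + y /\<^sub>R 2)) powr (- m) * (1 + norm (c - y /\<^sub>R 2)) powr (- n)
    \<le> ?K * (1 + norm y) powr (- (m + n))" .
qed

lemma integrable_decaying_prod:
  fixes f g :: "'a::euclidean_space \<Rightarrow> complex"
  assumes f: "cont_decaying f" and g: "cont_decaying g"
  shows "integrable lborel (\<lambda>x. cnj (f x) * g x)"
proof -
  obtain m C where f': "m > real DIM('a) / 2" "C \<ge> 0" "\<And>x. norm (f x) \<le> C * (1 + norm x) powr (- m)"
    using f decayingE unfolding cont_decaying_def by blast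
  obtain n D where g': "n > real DIM('a) / 2" "D \<ge> 0" "\<And>x. norm (g x) \<le> D * (1 + norm x) powr (- n)"
    using g decayingE unfolding cont_decaying_def by blast
  have "integrable lborel (\<lambda>x::'a. (C * D) * (1 + norm x) powr (- (m + n)))"
    using f' g' by (intro integrable_mult_right integrable_powr_norm) simp
  then show ?thesis
  proof (rule Bochner_Integration.integrable_bound)
    show "(\<lambda>x. cnj (f x) * g x) \<in> borel_measurable lborel"
      using f g unfolding cont_decaying_def
      by (auto intro!: borel_measurable_continuous_onI continuous_intros)
    show "AE x in lborel. norm (cnj (f x) * g x) \<le> norm ((C * D) * (1 + norm x) powr (- (m + n)))"
    proof (rule AE_I2)
      fix x
      have "norm (cnj (f x) * g x) \<le> (C * (1 + norm x) powr (- m)) * (D * (1 + norm x) powr (- n))"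
        unfolding norm_mult complex_mod_cnj using f' g' by (intro mult_mono) auto
      also have "\<dots> = (C * D) * (1 + norm x) powr (- (m + n))"
        by (simp add: powr_add[symmetric] algebra_simps)
      finally show "norm (cnj (f x) * g x) \<le> norm ((C * D) * (1 + norm x) powr (- (m + n)))"
        using f' g' by simp
    qed
  qed
qed

section \<open>The Wigner integral with two base points\<close>

text \<open>The two base points \<open>a\<close> and \<open>c\<close> are kept independent: they coincide in the Wigner transform, but
  translating \<open>y\<close> moves them in opposite directions.\<close>

definition wigner_integrand :: "('a::euclidean_space \<Rightarrow> complex) \<Rightarrow> ('a \<Rightarrow> complex) \<Rightarrow> 'a \<Rightarrow> 'a \<Rightarrow> 'a \<Rightarrow> 'a \<Rightarrow> complex" where
  "wigner_integrand f g p a c y = exp (\<i> * of_real (y \<bullet> p)) * cnj (f (a + y /\<^sub>R 2)) * g (c - y /\<^sub>R 2)"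

definition cross_wigner :: "('a::euclidean_space \<Rightarrow> complex) \<Rightarrow> ('a \<Rightarrow> complex) \<Rightarrow> 'a \<Rightarrow> 'a \<Rightarrow> 'a \<Rightarrow> complex" where
  "cross_wigner f g p a c = (\<integral>y. wigner_integrand f g p a c y \<partial>lborel)"

lemma wigner_eq_cross_wigner:
  "wigner f g x p = 1 / of_real ((2 * pi) ^ DIM('a)) * cross_wigner f g p x x" for x :: "'a::euclidean_space"
  by (simp add: wigner_def cross_wigner_def wigner_integrand_def)

lemma norm_wigner_integrand:
  "norm (wigner_integrand f g p a c y) = norm (f (a + y /\<^sub>R 2)) * norm (g (c - y /\<^sub>R 2))"
  by (simp add: wigner_integrand_def norm_mult)

lemma borel_measurable_wigner_integrand:
  fixes f g :: "'a::euclidean_space \<Rightarrow> complex"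
  assumes "continuous_on UNIV f" "continuous_on UNIV g"
  shows "wigner_integrand f g p a c \<in> borel_measurable borel"
  unfolding wigner_integrand_def[abs_def]
  by (intro borel_measurable_continuous_onI continuous_intros
       continuous_on_compose2[OF assms(1)] continuous_on_compose2[OF assms(2)]) auto

lemma ex_wigner_integrand_bound:
  fixes f g :: "'a::euclidean_space \<Rightarrow> complex"
  assumes f: "decaying f" and g: "decaying g"
  obtains G :: "'a \<Rightarrow> real" where "integrable lborel G"
    "\<And>a c y. norm a \<le> R \<Longrightarrow> norm c \<le> R \<Longrightarrow> norm (f (a + y /\<^sub>R 2)) * norm (g (c - y /\<^sub>R 2)) \<le> G y"
proof -
  obtain m C where f': "m > real DIM('a) / 2" "C \<ge> 0" "\<And>x. norm (f x) \<le> C * (1 + norm x) powr (- m)"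
    using decayingE[OF f] by blast
  obtain n D where g': "n > real DIM('a) / 2" "D \<ge> 0" "\<And>x. norm (g x) \<le> D * (1 + norm x) powr (- n)"
    using decayingE[OF g] by blast
  obtain G :: "'a \<Rightarrow> real" where G: "integrable lborel G" "\<And>a c y. norm a \<le> R \<Longrightarrow> norm c \<le> R \<Longrightarrow>
      (1 + norm (a + y /\<^sub>R 2)) powr (- m) * (1 + norm (c - y /\<^sub>R 2)) powr (- n) \<le> G y"
    using ex_dominating[OF f'(1) g'(1)] by blast
  show ?thesis
  proof (rule that)
    show "integrable lborel (\<lambda>y. (C * D) * G y)" using G by simp
    fix a c y :: 'a assume *: "norm a \<le> R" "norm c \<le> R"
    have "norm (f (a + y /\<^sub>R 2)) * norm (g (c - y /\<^sub>R 2))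
      \<le> (C * (1 + norm (a + y /\<^sub>R 2)) powr (- m)) * (D * (1 + norm (c - y /\<^sub>R 2)) powr (- n))"
      using f' g' by (intro mult_mono) auto
    also have "\<dots> = (C * D) * ((1 + norm (a + y /\<^sub>R 2)) powr (- m) * (1 + norm (c - y /\<^sub>R 2)) powr (- n))"
      by simp
    also have "\<dots> \<le> (C * D) * G y"
      using * f' g' by (intro mult_left_mono G) auto
    finally show "norm (f (a + y /\<^sub>R 2)) * norm (g (c - y /\<^sub>R 2)) \<le> (C * D) * G y" .
  qed
qed

lemma integrable_wigner_integrand:
  fixes f g :: "'a::euclidean_space \<Rightarrow> complex"
  assumes f: "cont_decaying f" and g: "cont_decaying g"
  shows "integrable lborel (wigner_integrand f g p a c)"
proof -
  have d: "decaying f" "decaying g" using f g by (auto simp: cont_decaying_def)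
  obtain G :: "'a \<Rightarrow> real" where G: "integrable lborel G"
    "\<And>a' c' y. norm a' \<le> max (norm a) (norm c) \<Longrightarrow> norm c' \<le> max (norm a) (norm c) \<Longrightarrow>
       norm (f (a' + y /\<^sub>R 2)) * norm (g (c' - y /\<^sub>R 2)) \<le> G y"
    using ex_wigner_integrand_bound[OF d] by blast
  show ?thesis
  proof (rule Bochner_Integration.integrable_bound[OF G(1)])
    show "wigner_integrand f g p a c \<in> borel_measurable lborel"
      using borel_measurable_wigner_integrand[of f g] f g by (simp add: cont_decaying_def)
    show "AE y in lborel. norm (wigner_integrand f g p a c y) \<le> norm (G y)"
      unfolding norm_wigner_integrand by (intro AE_I2 order_trans[OF G(2)]) auto
  qed
qed

lemma ex_cross_wigner_bound:
  fixes f g :: "'a::euclidean_space \<Rightarrow> complex"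
  assumes f: "cont_decaying f" and g: "cont_decaying g"
  obtains B where "\<And>p. norm (cross_wigner f g p a c) \<le> B"
proof
  show "norm (cross_wigner f g p a c) \<le> (\<integral>y. norm (f (a + y /\<^sub>R 2)) * norm (g (c - y /\<^sub>R 2)) \<partial>lborel)" for p
    unfolding cross_wigner_def norm_wigner_integrand[where p = p, symmetric] by (rule integral_norm_bound)
qed

lemma cross_wigner_add_left:
  assumes "cont_decaying f1" "cont_decaying f2" "cont_decaying g"
  shows "cross_wigner (\<lambda>x. f1 x + f2 x) g p a c = cross_wigner f1 g p a c + cross_wigner f2 g p a c"
proof -
  have "wigner_integrand (\<lambda>x. f1 x + f2 x) g p a c = (\<lambda>y. wigner_integrand f1 g p a c y + wigner_integrand f2 g p a c y)"
    by (simp add: wigner_integrand_def fun_eq_iff algebra_simps)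
  then show ?thesis
    unfolding cross_wigner_def using assms by (simp add: integrable_wigner_integrand)
qed

lemma cross_wigner_add_right:
  assumes "cont_decaying f" "cont_decaying g1" "cont_decaying g2"
  shows "cross_wigner f (\<lambda>x. g1 x + g2 x) p a c = cross_wigner f g1 p a c + cross_wigner f g2 p a c"
proof -
  have "wigner_integrand f (\<lambda>x. g1 x + g2 x) p a c = (\<lambda>y. wigner_integrand f g1 p a c y + wigner_integrand f g2 p a c y)"
    by (simp add: wigner_integrand_def fun_eq_iff algebra_simps)
  then show ?thesis
    unfolding cross_wigner_def using assms by (simp add: integrable_wigner_integrand)
qed

lemma cross_wigner_cmult_left: "cross_wigner (\<lambda>x. k * f x) g p a c = cnj k * cross_wigner f g p a c"
proof -
  have "wigner_integrand (\<lambda>x. k * f x) g p a c = (\<lambda>y. cnj k * wigner_integrand f g p a c y)"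
    by (simp add: wigner_integrand_def fun_eq_iff)
  then show ?thesis
    unfolding cross_wigner_def by simp
qed

lemma cross_wigner_cmult_right: "cross_wigner f (\<lambda>x. k * g x) p a c = k * cross_wigner f g p a c"
proof -
  have "wigner_integrand f (\<lambda>x. k * g x) p a c = (\<lambda>y. k * wigner_integrand f g p a c y)"
    by (simp add: wigner_integrand_def fun_eq_iff)
  then show ?thesis
    unfolding cross_wigner_def by simp
qed

lemma cross_wigner_zero: "cross_wigner (\<lambda>_. 0) g p a c = 0" "cross_wigner f (\<lambda>_. 0) p a c = 0"
  by (simp_all add: cross_wigner_def wigner_integrand_def)

lemma cross_wigner_diff_left:
  "cont_decaying f1 \<Longrightarrow> cont_decaying f2 \<Longrightarrow> cont_decaying g \<Longrightarrow>
    cross_wigner (\<lambda>x. f1 x - f2 x) g p a c = cross_wigner f1 g p a c - cross_wigner f2 g p a c"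
  using cross_wigner_add_left[of f1 "\<lambda>x. (-1) * f2 x" g p a c] cont_decaying_cmult[of f2 "-1"]
    cross_wigner_cmult_left[of "-1" f2 g p a c] by simp

lemma cross_wigner_diff_right:
  "cont_decaying f \<Longrightarrow> cont_decaying g1 \<Longrightarrow> cont_decaying g2 \<Longrightarrow>
    cross_wigner f (\<lambda>x. g1 x - g2 x) p a c = cross_wigner f g1 p a c - cross_wigner f g2 p a c"
  using cross_wigner_add_right[of f g1 "\<lambda>x. (-1) * g2 x" p a c] cont_decaying_cmult[of g2 "-1"]
    cross_wigner_cmult_right[of f "-1" g2 p a c] by simp

lemma cross_wigner_sum_left:
  assumes "cont_decaying g" "\<And>i. i \<in> A \<Longrightarrow> cont_decaying (f i)"
  shows "cross_wigner (\<lambda>x. \<Sum>i\<in>A. f i x) g p a c = (\<Sum>i\<in>A. cross_wigner (f i) g p a c)"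
  using assms(2)
proof (induction A rule: infinite_finite_induct)
  case (insert i A)
  then show ?case by (simp add: cross_wigner_add_left cont_decaying_sum assms(1))
qed (simp_all add: cross_wigner_zero)

lemma cross_wigner_sum_right:
  assumes "cont_decaying f" "\<And>i. i \<in> A \<Longrightarrow> cont_decaying (g i)"
  shows "cross_wigner f (\<lambda>x. \<Sum>i\<in>A. g i x) p a c = (\<Sum>i\<in>A. cross_wigner f (g i) p a c)"
  using assms(2)
proof (induction A rule: infinite_finite_induct)
  case (insert i A)
  then show ?case by (simp add: cross_wigner_add_right cont_decaying_sum assms(1))
qed (simp_all add: cross_wigner_zero)

lemma cnj_cross_wigner:
  assumes "cont_decaying f" "cont_decaying g"
  shows "cnj (cross_wigner f g p a c) = cross_wigner g f p c a"
proof -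
  have m: "wigner_integrand g f p c a \<in> borel_measurable borel"
    using borel_measurable_wigner_integrand[of g f] assms by (simp add: cont_decaying_def)
  have "cnj (cross_wigner f g p a c) = (\<integral>y. cnj (wigner_integrand f g p a c y) \<partial>lborel)"
    unfolding cross_wigner_def by simp
  also have "\<dots> = (\<integral>y. wigner_integrand g f p c a (0 + (-1) *\<^sub>R y) \<partial>lborel)"
    by (intro Bochner_Integration.integral_cong) (auto simp: wigner_integrand_def exp_cnj)
  also have "\<dots> = cross_wigner g f p c a"
    unfolding cross_wigner_def by (subst lborel_integral_affine[OF _ m, of "-1" 0]) simp_all
  finally show ?thesis .
qed

section \<open>Derivatives of the Wigner integral and integration by parts\<close>

definition C1_decaying :: "('a::euclidean_space \<Rightarrow> complex) \<Rightarrow> bool" where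
  "C1_decaying f \<longleftrightarrow> (\<forall>x. f differentiable (at x)) \<and> cont_decaying f \<and> (\<forall>b\<in>Basis. cont_decaying (pdiff b f))"

lemma has_derivative_pdiff:
  fixes f :: "'a::euclidean_space \<Rightarrow> complex"
  assumes "f differentiable (at x)"
  shows "(f has_derivative (\<lambda>h. \<Sum>b\<in>Basis. of_real (h \<bullet> b) * pdiff b f x)) (at x)"
proof -
  have D: "(f has_derivative frechet_derivative f (at x)) (at x)"
    using assms by (rule frechet_derivative_works[THEN iffD1])
  have "frechet_derivative f (at x) h = (\<Sum>b\<in>Basis. of_real (h \<bullet> b) * pdiff b f x)" for h
  proof -
    have lin: "linear (frechet_derivative f (at x))"
      using D by (rule has_derivative_linear)
    have "frechet_derivative f (at x) (\<Sum>b\<in>Basis. (h \<bullet> b) *\<^sub>R b) = (\<Sum>b\<in>Basis. (h \<bullet> b) *\<^sub>R frechet_derivative f (at x) b)"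
      by (simp add: linear_sum[OF lin] linear_scale[OF lin])
    then show ?thesis
      by (simp add: euclidean_representation pdiff_def scaleR_conv_of_real)
  qed
  then have "frechet_derivative f (at x) = (\<lambda>h. \<Sum>b\<in>Basis. of_real (h \<bullet> b) * pdiff b f x)"
    by (rule ext)
  with D show ?thesis
    by simp
qed

lemma has_derivative_wigner_integrand:
  fixes f g :: "'a::euclidean_space \<Rightarrow> complex"
  assumes f: "\<And>x. f differentiable (at x)" and g: "\<And>x. g differentiable (at x)"
  shows "((\<lambda>q. wigner_integrand f g p (fst q) (snd q) y) has_derivative
     (\<lambda>h. (\<Sum>b\<in>Basis. of_real (fst h \<bullet> b) * wigner_integrand (pdiff b f) g p (fst q) (snd q) y)
        + (\<Sum>b\<in>Basis. of_real (snd h \<bullet> b) * wigner_integrand f (pdiff b g) p (fst q) (snd q) y))) (at q)"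
proof -
  have 1: "((\<lambda>q. f (fst q + y /\<^sub>R 2)) has_derivative
     (\<lambda>h. \<Sum>b\<in>Basis. of_real (fst h \<bullet> b) * pdiff b f (fst q + y /\<^sub>R 2))) (at q)"
    by (rule has_derivative_compose[OF _ has_derivative_pdiff[OF f], where f="\<lambda>q. fst q + y /\<^sub>R 2" and f'=fst])
       (auto intro!: derivative_eq_intros)
  have 2: "((\<lambda>q. g (snd q - y /\<^sub>R 2)) has_derivative
     (\<lambda>h. \<Sum>b\<in>Basis. of_real (snd h \<bullet> b) * pdiff b g (snd q - y /\<^sub>R 2))) (at q)"
    by (rule has_derivative_compose[OF _ has_derivative_pdiff[OF g], where f="\<lambda>q. snd q - y /\<^sub>R 2" and f'=snd])
       (auto intro!: derivative_eq_intros)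
  have "((\<lambda>q. exp (\<i> * of_real (y \<bullet> p)) * cnj (f (fst q + y /\<^sub>R 2)) * g (snd q - y /\<^sub>R 2)) has_derivative
     (\<lambda>h. exp (\<i> * of_real (y \<bullet> p)) * cnj (f (fst q + y /\<^sub>R 2)) * (\<Sum>b\<in>Basis. of_real (snd h \<bullet> b) * pdiff b g (snd q - y /\<^sub>R 2))
       + (exp (\<i> * of_real (y \<bullet> p)) * cnj (\<Sum>b\<in>Basis. of_real (fst h \<bullet> b) * pdiff b f (fst q + y /\<^sub>R 2))) * g (snd q - y /\<^sub>R 2))) (at q)"
    by (intro has_derivative_mult has_derivative_mult_right has_derivative_cnj 1 2)
  then show ?thesis
    unfolding wigner_integrand_def
    by (rule has_derivative_eq_rhs)
       (auto simp: fun_eq_iff sum_distrib_left sum_distrib_right algebra_simps intro!: sum.cong)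
qed

lemma decaying_norm: "decaying f \<Longrightarrow> decaying (\<lambda>x. of_real (norm (f x)))"
  by (erule decaying_mono) simp

lemma norm_sum_Basis_le:
  fixes v :: "'a::euclidean_space" and X :: "'a \<Rightarrow> complex"
  shows "norm (\<Sum>b\<in>Basis. of_real (v \<bullet> b) * X b) \<le> norm v * (\<Sum>b\<in>Basis. norm (X b))"
proof -
  have "norm (\<Sum>b\<in>Basis. of_real (v \<bullet> b) * X b) \<le> (\<Sum>b\<in>Basis. norm v * norm (X b))"
    by (intro sum_norm_le) (auto simp: norm_mult intro!: mult_right_mono Basis_le_norm)
  then show ?thesis by (simp add: sum_distrib_left)
qed

lemma has_derivative_cross_wigner:
  fixes f g :: "'a::euclidean_space \<Rightarrow> complex"
  assumes f: "C1_decaying f" and g: "C1_decaying g"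
  shows "((\<lambda>q. cross_wigner f g p (fst q) (snd q)) has_derivative
     (\<lambda>h. (\<Sum>b\<in>Basis. of_real (fst h \<bullet> b) * cross_wigner (pdiff b f) g p a c)
        + (\<Sum>b\<in>Basis. of_real (snd h \<bullet> b) * cross_wigner f (pdiff b g) p a c))) (at (a, c))"
proof -
  have fc: "cont_decaying f" "\<And>b. b \<in> Basis \<Longrightarrow> cont_decaying (pdiff b f)" "\<And>x. f differentiable (at x)"
    and gc: "cont_decaying g" "\<And>b. b \<in> Basis \<Longrightarrow> cont_decaying (pdiff b g)" "\<And>x. g differentiable (at x)"
    using f g by (auto simp: C1_decaying_def)
  \<comment> \<open>Majorises \<open>f\<close> and all its first partial derivatives at once.\<close>
  define maj :: "('a \<Rightarrow> complex) \<Rightarrow> 'a \<Rightarrow> complex" where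
    "maj = (\<lambda>f x. of_real (norm (f x)) + (\<Sum>b\<in>Basis. of_real (norm (pdiff b f x))))"
  have maj: "decaying (maj f)" "decaying (maj g)"
    using fc gc unfolding maj_def cont_decaying_def by (auto intro!: decaying_add decaying_sum decaying_norm)
  have norm_maj: "norm (maj f x) = norm (f x) + (\<Sum>b\<in>Basis. norm (pdiff b f x))" for f x
  proof -
    have "maj f x = of_real (norm (f x) + (\<Sum>b\<in>Basis. norm (pdiff b f x)))"
      by (simp add: maj_def)
    then show ?thesis
      by (simp only: norm_of_real) (simp add: sum_nonneg)
  qed
  define R where "R = norm (a, c) + 1"
  obtain G :: "'a \<Rightarrow> real" where G: "integrable lborel G"
    "\<And>a c y. norm a \<le> R \<Longrightarrow> norm c \<le> R \<Longrightarrow> norm (maj f (a + y /\<^sub>R 2)) * norm (maj g (c - y /\<^sub>R 2)) \<le> G y"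
    using ex_wigner_integrand_bound[OF maj] by blast
  let ?D = "\<lambda>q h y. (\<Sum>b\<in>Basis. of_real (fst h \<bullet> b) * wigner_integrand (pdiff b f) g p (fst q) (snd q) y)
        + (\<Sum>b\<in>Basis. of_real (snd h \<bullet> b) * wigner_integrand f (pdiff b g) p (fst q) (snd q) y)"
  have "((\<lambda>q. \<integral>y. wigner_integrand f g p (fst q) (snd q) y \<partial>lborel) has_derivative
      (\<lambda>h. \<integral>y. ?D (a, c) h y \<partial>lborel)) (at (a, c))"
  proof (rule has_derivative_integral_dominated[where r=1 and g=G and f'="?D"])
    show "integrable lborel (wigner_integrand f g p (fst q) (snd q))" for q
      by (rule integrable_wigner_integrand[OF fc(1) gc(1)])
    show "?D (a, c) h \<in> borel_measurable lborel" for h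
      using fc gc unfolding cont_decaying_def by (auto intro!: borel_measurable_add borel_measurable_sum borel_measurable_times borel_measurable_wigner_integrand)
    show "((\<lambda>q. wigner_integrand f g p (fst q) (snd q) y) has_derivative (\<lambda>h. ?D q h y)) (at q)" for q y
      by (rule has_derivative_wigner_integrand[OF fc(3) gc(3)])
    show "norm (?D q h y) \<le> G y * norm h" if q: "q \<in> ball (a, c) 1" for q h y
    proof -
      let ?u = "fst q + y /\<^sub>R 2" and ?v = "snd q - y /\<^sub>R 2"
      let ?S = "\<Sum>b\<in>Basis. norm (pdiff b f ?u)" and ?T = "\<Sum>b\<in>Basis. norm (pdiff b g ?v)"
      have nn: "?S \<ge> 0" "?T \<ge> 0" by (auto intro: sum_nonneg)
      have nh: "norm (fst h) \<le> norm h" "norm (snd h) \<le> norm h"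
        by (metis norm_fst_le prod.collapse, metis norm_snd_le prod.collapse)
      have nq: "norm q \<le> R"
        using q norm_triangle_ineq2[of q "(a, c)"] by (simp add: R_def dist_norm norm_minus_commute)
      have "norm (?D q h y) \<le> norm (fst h) * (\<Sum>b\<in>Basis. norm (wigner_integrand (pdiff b f) g p (fst q) (snd q) y))
          + norm (snd h) * (\<Sum>b\<in>Basis. norm (wigner_integrand f (pdiff b g) p (fst q) (snd q) y))"
        by (intro norm_triangle_le add_mono norm_sum_Basis_le)
      also have "\<dots> = norm (fst h) * (?S * norm (g ?v)) + norm (snd h) * (norm (f ?u) * ?T)"
        by (simp add: norm_wigner_integrand sum_distrib_left sum_distrib_right)
      also have "\<dots> \<le> norm h * (?S * norm (g ?v)) + norm h * (norm (f ?u) * ?T)"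
        using nn nh by (intro add_mono mult_right_mono mult_nonneg_nonneg) auto
      also have "\<dots> = norm h * (?S * norm (g ?v) + norm (f ?u) * ?T)"
        by (simp add: algebra_simps)
      also have "\<dots> \<le> norm h * ((norm (f ?u) + ?S) * (norm (g ?v) + ?T))"
        using nn by (intro mult_left_mono) (auto simp: algebra_simps intro!: add_nonneg_nonneg mult_nonneg_nonneg)
      also have "\<dots> = norm h * (norm (maj f ?u) * norm (maj g ?v))"
        by (simp add: norm_maj)
      also have "\<dots> \<le> norm h * G y"
        using nq norm_fst_le[of "fst q" "snd q"] norm_snd_le[of "snd q" "fst q"]
        by (intro mult_left_mono G(2)) auto
      finally show ?thesis by (simp add: mult.commute)
    qed
  qed (simp_all add: G)
  then show ?thesis
    unfolding cross_wigner_def[symmetric]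
  proof (rule has_derivative_eq_rhs, intro ext)
    fix h :: "'a \<times> 'a"
    show "(\<integral>y. ?D (a, c) h y \<partial>lborel) = (\<Sum>b\<in>Basis. of_real (fst h \<bullet> b) * cross_wigner (pdiff b f) g p a c)
        + (\<Sum>b\<in>Basis. of_real (snd h \<bullet> b) * cross_wigner f (pdiff b g) p a c)"
      using fc gc by (simp add: cross_wigner_def integrable_wigner_integrand)
  qed
qed

lemma sum_Basis_single:
  fixes b :: "'a::euclidean_space" and X :: "'a \<Rightarrow> complex"
  assumes "b \<in> Basis"
  shows "(\<Sum>b'\<in>Basis. of_real ((s *\<^sub>R b) \<bullet> b') * X b') = of_real s * X b"
proof -
  have "(\<Sum>b'\<in>Basis. of_real ((s *\<^sub>R b) \<bullet> b') * X b') = (\<Sum>b'\<in>Basis. if b = b' then of_real s * X b' else 0)"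
    using assms by (intro sum.cong) (auto simp: inner_Basis)
  then show ?thesis using assms by simp
qed

text \<open>Translation of the integration variable: the infinitesimal form of this invariance replaces
  integration by parts.\<close>

lemma cross_wigner_shift:
  fixes f g :: "'a::euclidean_space \<Rightarrow> complex"
  assumes "cont_decaying f" "cont_decaying g"
  shows "cross_wigner f g p a c = exp (\<i> * of_real (v \<bullet> p)) * cross_wigner f g p (a + v /\<^sub>R 2) (c - v /\<^sub>R 2)"
proof -
  have m: "wigner_integrand f g p a c \<in> borel_measurable borel"
    using borel_measurable_wigner_integrand[of f g] assms by (simp add: cont_decaying_def)
  have "cross_wigner f g p a c = (\<integral>y. wigner_integrand f g p a c (v + 1 *\<^sub>R y) \<partial>lborel)"
    unfolding cross_wigner_def by (subst lborel_integral_affine[OF _ m, of 1 v]) simp_all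
  also have "\<dots> = (\<integral>y. exp (\<i> * of_real (v \<bullet> p)) * wigner_integrand f g p (a + v /\<^sub>R 2) (c - v /\<^sub>R 2) y \<partial>lborel)"
    by (intro Bochner_Integration.integral_cong refl)
       (simp add: wigner_integrand_def inner_add_left distrib_left exp_add scaleR_add_right add.assoc diff_diff_eq)
  finally show ?thesis
    unfolding cross_wigner_def by simp
qed

text \<open>The right-hand side of \<open>cross_wigner_shift\<close> for \<open>v = s b\<close> does not depend on \<open>s\<close>. Its derivative at \<open>s = 0\<close>
  consists of \<open>i p\<^sub>b\<close> from the phase and of half the difference of the two base point derivatives.\<close>

lemma cross_wigner_by_parts:
  fixes f g :: "'a::euclidean_space \<Rightarrow> complex"
  assumes f: "C1_decaying f" and g: "C1_decaying g" and b: "b \<in> Basis"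
  shows "of_real (p \<bullet> b) * cross_wigner f g p a c = \<i> / 2 * (cross_wigner (pdiff b f) g p a c - cross_wigner f (pdiff b g) p a c)"
proof -
  have fg: "cont_decaying f" "cont_decaying g" using f g by (auto simp: C1_decaying_def)
  let ?k = "\<lambda>s. (a + (s / 2) *\<^sub>R b, c - (s / 2) *\<^sub>R b)"
  let ?X = "cross_wigner (pdiff b f) g p a c" and ?Y = "cross_wigner f (pdiff b g) p a c"
  have k: "(?k has_derivative (\<lambda>s. ((s / 2) *\<^sub>R b, - ((s / 2) *\<^sub>R b)))) (at 0)"
    by (auto intro!: derivative_eq_intros)
  have "((\<lambda>s. cross_wigner f g p (fst (?k s)) (snd (?k s))) has_derivative
     (\<lambda>s. (\<Sum>b'\<in>Basis. of_real (fst ((s / 2) *\<^sub>R b, - ((s / 2) *\<^sub>R b)) \<bullet> b') * cross_wigner (pdiff b' f) g p a c)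
        + (\<Sum>b'\<in>Basis. of_real (snd ((s / 2) *\<^sub>R b, - ((s / 2) *\<^sub>R b)) \<bullet> b') * cross_wigner f (pdiff b' g) p a c))) (at 0)"
    by (rule has_derivative_compose[OF k]) (use has_derivative_cross_wigner[OF f g] in simp)
  then have "((\<lambda>s. cross_wigner f g p (fst (?k s)) (snd (?k s))) has_derivative
     (\<lambda>s. (\<Sum>b'\<in>Basis. of_real (((s / 2) *\<^sub>R b) \<bullet> b') * cross_wigner (pdiff b' f) g p a c)
        + (\<Sum>b'\<in>Basis. of_real (((- (s / 2)) *\<^sub>R b) \<bullet> b') * cross_wigner f (pdiff b' g) p a c))) (at 0)"
    by simp
  then have "((\<lambda>s. cross_wigner f g p (fst (?k s)) (snd (?k s))) has_derivative
     (\<lambda>s. of_real (s / 2) * ?X + of_real (- (s / 2)) * ?Y)) (at 0)"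
    unfolding sum_Basis_single[OF b] .
  then have "((\<lambda>s. cross_wigner f g p (fst (?k s)) (snd (?k s))) has_vector_derivative (?X - ?Y) / 2) (at 0)"
    unfolding has_vector_derivative_def
    by (rule has_derivative_eq_rhs) (auto simp: scaleR_conv_of_real field_simps)
  moreover have "((\<lambda>s. exp (\<i> * of_real ((s *\<^sub>R b) \<bullet> p))) has_vector_derivative \<i> * of_real (p \<bullet> b)) (at 0)"
  proof -
    have "((\<lambda>s. exp (s *\<^sub>R (\<i> * of_real (b \<bullet> p)))) has_vector_derivative
        (exp (0 *\<^sub>R (\<i> * of_real (b \<bullet> p))) * (\<i> * of_real (b \<bullet> p)))) (at (0::real))"
      by (rule exp_scaleR_has_vector_derivative_right)
    then show ?thesis
      by (simp add: scaleR_conv_of_real inner_commute mult_ac)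
  qed
  ultimately have "((\<lambda>s. exp (\<i> * of_real ((s *\<^sub>R b) \<bullet> p)) * cross_wigner f g p (fst (?k s)) (snd (?k s))) has_vector_derivative
      exp (\<i> * of_real ((0 *\<^sub>R b) \<bullet> p)) * ((?X - ?Y) / 2) + \<i> * of_real (p \<bullet> b) * cross_wigner f g p (fst (?k 0)) (snd (?k 0))) (at 0)"
    by (rule has_vector_derivative_mult[rotated])
  moreover have "exp (\<i> * of_real ((s *\<^sub>R b) \<bullet> p)) * cross_wigner f g p (fst (?k s)) (snd (?k s)) = cross_wigner f g p a c" for s
  proof -
    have "(s *\<^sub>R b) /\<^sub>R 2 = (s / 2) *\<^sub>R b"
      by simp
    then show ?thesis
      using cross_wigner_shift[OF fg, of p a c "s *\<^sub>R b"] by (simp only: fst_conv snd_conv)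
  qed
  ultimately have "((\<lambda>s::real. cross_wigner f g p a c) has_vector_derivative (?X - ?Y) / 2 + \<i> * of_real (p \<bullet> b) * cross_wigner f g p a c) (at 0)"
    by simp
  then have "(?X - ?Y) / 2 + \<i> * of_real (p \<bullet> b) * cross_wigner f g p a c = 0"
    by (rule vector_derivative_unique_at) (rule has_vector_derivative_const)
  then have "\<i> * ((?X - ?Y) / 2 + \<i> * of_real (p \<bullet> b) * cross_wigner f g p a c) = 0"
    by simp
  then show ?thesis
    by (simp add: algebra_simps)
qed

section \<open>Decay in momentum and inversion of the Wigner integral\<close>

definition Cinf_decaying :: "('a::euclidean_space \<Rightarrow> complex) \<Rightarrow> bool" where
  "Cinf_decaying f \<longleftrightarrow> (\<forall>bs. set bs \<subseteq> Basis \<longrightarrow>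
     (\<forall>x. foldr pdiff bs f differentiable (at x)) \<and> decaying (foldr pdiff bs f))"

lemma Cinf_decaying_pdiff:
  assumes "Cinf_decaying f" "b \<in> Basis" shows "Cinf_decaying (pdiff b f)"
  unfolding Cinf_decaying_def
proof (intro allI impI)
  fix bs :: "'a list" assume "set bs \<subseteq> Basis"
  then show "(\<forall>x. foldr pdiff bs (pdiff b f) differentiable (at x)) \<and> decaying (foldr pdiff bs (pdiff b f))"
    using assms(1)[unfolded Cinf_decaying_def, rule_format, of "bs @ [b]"] assms(2) by simp
qed

lemma Cinf_decaying_cont_decaying: assumes "Cinf_decaying f" shows "cont_decaying f"
  using assms[unfolded Cinf_decaying_def, rule_format, of "[]"]
  by (auto simp: cont_decaying_def intro!: continuous_at_imp_continuous_on differentiable_imp_continuous_within)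

lemma Cinf_decaying_C1_decaying: "Cinf_decaying f \<Longrightarrow> C1_decaying f"
  using Cinf_decaying_def[of f, THEN iffD1, rule_format, of "[]"]
  by (auto simp: C1_decaying_def intro!: Cinf_decaying_cont_decaying Cinf_decaying_pdiff)

lemma cross_wigner_by_parts2:
  fixes f g :: "'a::euclidean_space \<Rightarrow> complex"
  assumes f: "Cinf_decaying f" and g: "Cinf_decaying g" and b: "b \<in> Basis"
  shows "of_real ((p \<bullet> b)\<^sup>2) * cross_wigner f g p a c = - (1/4) * (cross_wigner (pdiff b (pdiff b f)) g p a c
     - 2 * cross_wigner (pdiff b f) (pdiff b g) p a c + cross_wigner f (pdiff b (pdiff b g)) p a c)"
proof -
  note n = Cinf_decaying_C1_decaying f g Cinf_decaying_pdiff b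
  have 1: "of_real (p \<bullet> b) * cross_wigner f g p a c = \<i> / 2 * (cross_wigner (pdiff b f) g p a c - cross_wigner f (pdiff b g) p a c)"
    and 2: "of_real (p \<bullet> b) * cross_wigner (pdiff b f) g p a c = \<i> / 2 * (cross_wigner (pdiff b (pdiff b f)) g p a c - cross_wigner (pdiff b f) (pdiff b g) p a c)"
    and 3: "of_real (p \<bullet> b) * cross_wigner f (pdiff b g) p a c = \<i> / 2 * (cross_wigner (pdiff b f) (pdiff b g) p a c - cross_wigner f (pdiff b (pdiff b g)) p a c)"
    by (rule cross_wigner_by_parts; intro n)+
  have "of_real ((p \<bullet> b)\<^sup>2) * cross_wigner f g p a c = of_real (p \<bullet> b) * (of_real (p \<bullet> b) * cross_wigner f g p a c)"
    by (simp add: power2_eq_square)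
  also have "\<dots> = \<i> / 2 * (of_real (p \<bullet> b) * cross_wigner (pdiff b f) g p a c - of_real (p \<bullet> b) * cross_wigner f (pdiff b g) p a c)"
    unfolding 1 by (simp add: algebra_simps)
  also have "\<dots> = - (1/4) * (cross_wigner (pdiff b (pdiff b f)) g p a c
     - 2 * cross_wigner (pdiff b f) (pdiff b g) p a c + cross_wigner f (pdiff b (pdiff b g)) p a c)"
    unfolding 2 3 by (simp add: algebra_simps)
  finally show ?thesis .
qed

text \<open>One factor \<open>1 + p\<^sub>b\<^sup>2\<close> is absorbed per coordinate, by \<open>cross_wigner_by_parts2\<close>; for this the induction
  ranges over all pairs \<open>f\<close>, \<open>g\<close>.\<close>

lemma cross_wigner_rapid_decay:
  fixes f g :: "'a::euclidean_space \<Rightarrow> complex"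
  assumes "finite A" "A \<subseteq> Basis" "Cinf_decaying f" "Cinf_decaying g"
  shows "\<exists>B. \<forall>p. (\<Prod>b\<in>A. 1 + (p \<bullet> b)\<^sup>2) * norm (cross_wigner f g p a c) \<le> B"
  using assms
proof (induction A arbitrary: f g rule: finite_induct)
  case empty
  then show ?case
    using ex_cross_wigner_bound[OF Cinf_decaying_cont_decaying Cinf_decaying_cont_decaying] by (metis mult_1 prod.empty)
next
  case (insert b A)
  then have b: "b \<in> Basis" and A: "A \<subseteq> Basis" by auto
  note n = insert.prems(2,3) Cinf_decaying_pdiff b
  let ?P = "\<lambda>p. \<Prod>b\<in>A. 1 + (p \<bullet> b)\<^sup>2"
  obtain B0 where B0: "\<And>p. ?P p * norm (cross_wigner f g p a c) \<le> B0"
    using insert.IH[OF A, of f g] n by blast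
  obtain B1 where B1: "\<And>p. ?P p * norm (cross_wigner (pdiff b (pdiff b f)) g p a c) \<le> B1"
    using insert.IH[OF A, of "pdiff b (pdiff b f)" g] n by blast
  obtain B2 where B2: "\<And>p. ?P p * norm (cross_wigner (pdiff b f) (pdiff b g) p a c) \<le> B2"
    using insert.IH[OF A, of "pdiff b f" "pdiff b g"] n by blast
  obtain B3 where B3: "\<And>p. ?P p * norm (cross_wigner f (pdiff b (pdiff b g)) p a c) \<le> B3"
    using insert.IH[OF A, of f "pdiff b (pdiff b g)"] n by blast
  have "(\<Prod>b\<in>insert b A. 1 + (p \<bullet> b)\<^sup>2) * norm (cross_wigner f g p a c) \<le> B0 + 1/4 * (B1 + 2 * B2 + B3)" for p
  proof -
    let ?x = "cross_wigner (pdiff b (pdiff b f)) g p a c" and ?y = "cross_wigner (pdiff b f) (pdiff b g) p a c"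
      and ?z = "cross_wigner f (pdiff b (pdiff b g)) p a c"
    have P: "?P p \<ge> 0" by (intro prod_nonneg) auto
    have "(p \<bullet> b)\<^sup>2 * norm (cross_wigner f g p a c) = norm (of_real ((p \<bullet> b)\<^sup>2) * cross_wigner f g p a c)"
      unfolding norm_mult norm_of_real by simp
    also have "\<dots> = 1/4 * norm (?x - 2 * ?y + ?z)"
      unfolding cross_wigner_by_parts2[OF insert.prems(2,3) b] norm_mult by simp
    also have "\<dots> \<le> 1/4 * (norm ?x + 2 * norm ?y + norm ?z)"
      using norm_triangle_ineq[of "?x - 2 * ?y" ?z] norm_triangle_ineq4[of ?x "2 * ?y"]
      by (simp add: norm_mult)
    finally have "?P p * ((p \<bullet> b)\<^sup>2 * norm (cross_wigner f g p a c)) \<le> ?P p * (1/4 * (norm ?x + 2 * norm ?y + norm ?z))"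
      using P by (rule mult_left_mono)
    also have "\<dots> = 1/4 * (?P p * norm ?x + 2 * (?P p * norm ?y) + ?P p * norm ?z)"
      by (simp add: algebra_simps)
    also have "\<dots> \<le> 1/4 * (B1 + 2 * B2 + B3)"
      by (intro mult_left_mono add_mono B1 B2 B3) auto
    finally show ?thesis
      using insert.hyps B0[of p] by (simp add: algebra_simps)
  qed
  then show ?case by blast
qed

text \<open>The decay bound over all coordinates dominates the integral by the product of the functions
  \<open>1 / (1 + p\<^sub>b\<^sup>2)\<close>.\<close>

lemma integrable_cross_wigner:
  fixes f g :: "'a::euclidean_space \<Rightarrow> complex"
  assumes f: "Cinf_decaying f" and g: "Cinf_decaying g"
  shows "integrable lborel (\<lambda>p. cross_wigner f g p a c)"
proof -
  obtain B where B: "\<And>p. (\<Prod>b\<in>Basis. 1 + (p \<bullet> b)\<^sup>2) * norm (cross_wigner f g p a c) \<le> B"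
    using cross_wigner_rapid_decay[OF finite_Basis order_refl f g] by blast
  have 1: "integrable lborel (\<lambda>s::real. inverse (1 + s\<^sup>2))"
  proof (rule Bochner_Integration.integrable_bound)
    show "integrable lborel (\<lambda>s::real. 2 * (1 + \<bar>s\<bar>) powr (- 2))"
      by (intro integrable_mult_right integrable_powr_real) simp
    show "AE s in lborel. norm (inverse (1 + s\<^sup>2)) \<le> norm (2 * (1 + \<bar>s::real\<bar>) powr (- 2))"
    proof (rule AE_I2)
      fix s :: real
      have "(1 + \<bar>s\<bar>)\<^sup>2 \<le> 2 * (1 + s\<^sup>2)"
        using sum_squares_ge_zero[of "1 - \<bar>s\<bar>" 0] by (simp add: power2_eq_square algebra_simps)
      then show "norm (inverse (1 + s\<^sup>2)) \<le> norm (2 * (1 + \<bar>s\<bar>) powr (- 2))"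
        by (simp add: powr_minus powr_numeral add_pos_nonneg divide_simps)
    qed
  qed measurable
  have "integrable lborel (\<lambda>p::'a. B * (\<Prod>b\<in>Basis. inverse (1 + (p \<bullet> b)\<^sup>2)))"
    by (intro integrable_mult_right integrable_lborel_prod 1)
  then show ?thesis
  proof (rule Bochner_Integration.integrable_bound)
    show "(\<lambda>p. cross_wigner f g p a c) \<in> borel_measurable lborel"
    proof -
      have m [measurable]: "wigner_integrand f g 0 a c \<in> borel_measurable borel"
        using Cinf_decaying_cont_decaying[OF f] Cinf_decaying_cont_decaying[OF g] by (auto simp: cont_decaying_def intro: borel_measurable_wigner_integrand)
      have "cross_wigner f g p a c = (\<integral>y. exp (\<i> * of_real (y \<bullet> p)) * wigner_integrand f g 0 a c y \<partial>lborel)" for p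
        by (simp add: cross_wigner_def wigner_integrand_def mult.assoc)
      then show ?thesis by simp
    qed
    show "AE p in lborel. norm (cross_wigner f g p a c) \<le> norm (B * (\<Prod>b\<in>Basis. inverse (1 + (p \<bullet> b)\<^sup>2)))"
    proof (rule AE_I2)
      fix p :: 'a
      have P: "(\<Prod>b\<in>Basis. 1 + (p \<bullet> b)\<^sup>2) > 0"
        by (intro prod_pos) (auto simp: add_pos_nonneg)
      have "norm (cross_wigner f g p a c) \<le> B * inverse (\<Prod>b\<in>Basis. 1 + (p \<bullet> b)\<^sup>2)"
        using B[of p] P by (simp add: field_simps)
      also have "inverse (\<Prod>b\<in>Basis. 1 + (p \<bullet> b)\<^sup>2) = (\<Prod>b\<in>Basis. inverse (1 + (p \<bullet> b)\<^sup>2))"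
        using prod_inversef[of "\<lambda>b. 1 + (p \<bullet> b)\<^sup>2" Basis] by (simp add: o_def)
      finally show "norm (cross_wigner f g p a c) \<le> norm (B * (\<Prod>b\<in>Basis. inverse (1 + (p \<bullet> b)\<^sup>2)))"
        by simp
    qed
  qed
qed

lemma cross_wigner_inversion:
  fixes f g :: "'a::euclidean_space \<Rightarrow> complex"
  assumes f: "Cinf_decaying f" and g: "Cinf_decaying g"
  shows "(\<integral>p. exp (- (\<i> * of_real (y \<bullet> p))) * cross_wigner f g p a c \<partial>lborel)
    = of_real ((2 * pi) ^ DIM('a)) * (cnj (f (a + y /\<^sub>R 2)) * g (c - y /\<^sub>R 2))"
proof -
  let ?h = "\<lambda>z. cnj (f (a + z /\<^sub>R 2)) * g (c - z /\<^sub>R 2)"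
  have h: "?h = wigner_integrand f g 0 a c" by (simp add: wigner_integrand_def fun_eq_iff)
  have cross_wigner: "cross_wigner f g p a c = (\<integral>z. exp (\<i> * of_real (z \<bullet> p)) * ?h z \<partial>lborel)" for p
    by (simp add: cross_wigner_def wigner_integrand_def mult.assoc)
  have c: "cont_decaying f" "cont_decaying g" using f g by (auto intro: Cinf_decaying_cont_decaying)
  obtain m C where f': "m > real DIM('a) / 2" "C \<ge> 0" "\<And>x. norm (f x) \<le> C * (1 + norm x) powr (- m)"
    using c(1) decayingE unfolding cont_decaying_def by blast
  obtain n D where g': "n > real DIM('a) / 2" "D \<ge> 0" "\<And>x. norm (g x) \<le> D * (1 + norm x) powr (- n)"
    using c(2) decayingE unfolding cont_decaying_def by blast
  have mn: "m \<ge> 0" "n \<ge> 0"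
    using f'(1) g'(1) by (meson divide_nonneg_pos less_eq_real_def of_nat_0_le_iff order_trans zero_less_numeral)+
  have le1: "(1 + norm x) powr (- k) \<le> 1" if "k \<ge> 0" for k and x :: 'a
    using that powr_mono[of "- k" 0 "1 + norm x"] by (auto simp: add_nonneg_eq_0_iff split: if_splits)
  have "norm (f x) \<le> C" for x
    using order_trans[OF f'(3)[of x] mult_left_mono[OF le1[OF mn(1)] f'(2)]] by simp
  moreover have "norm (g x) \<le> D" for x
    using order_trans[OF g'(3)[of x] mult_left_mono[OF le1[OF mn(2)] g'(2)]] by simp
  ultimately have bdd: "norm (?h z) \<le> C * D" for z
    unfolding norm_mult complex_mod_cnj using f'(2) by (intro mult_mono) auto
  have cf: "continuous_on UNIV f" and cg: "continuous_on UNIV g"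
    using c by (auto simp: cont_decaying_def)
  have cont: "continuous_on UNIV ?h"
    by (intro continuous_intros continuous_on_compose2[OF cf] continuous_on_compose2[OF cg]) auto
  show ?thesis
    unfolding cross_wigner
  proof (rule fourier_inversion[OF cont bdd])
    show "integrable lborel ?h" unfolding h by (rule integrable_wigner_integrand[OF c])
    show "integrable lborel (\<lambda>p. \<integral>z. exp (\<i> * of_real (z \<bullet> p)) * ?h z \<partial>lborel)"
      unfolding cross_wigner[symmetric] by (rule integrable_cross_wigner[OF f g])
  qed
qed

section \<open>The Wigner transform: free transport, phase space integrals, potential\<close>

lemma has_derivative_wigner:
  fixes f g :: "'a::euclidean_space \<Rightarrow> complex"
  assumes f: "C1_decaying f" and g: "C1_decaying g"
  shows "((\<lambda>z. wigner f g z p) has_derivative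
    (\<lambda>h. \<Sum>b\<in>Basis. of_real (h \<bullet> b) * (wigner (pdiff b f) g x p + wigner f (pdiff b g) x p))) (at x)"
proof -
  have "((\<lambda>z. cross_wigner f g p (fst (z, z)) (snd (z, z))) has_derivative
     (\<lambda>h. (\<Sum>b\<in>Basis. of_real (fst (h, h) \<bullet> b) * cross_wigner (pdiff b f) g p x x)
        + (\<Sum>b\<in>Basis. of_real (snd (h, h) \<bullet> b) * cross_wigner f (pdiff b g) p x x))) (at x)"
    by (rule has_derivative_compose[where f="\<lambda>z. (z, z)" and f'="\<lambda>h. (h, h)", OF _ has_derivative_cross_wigner[OF f g]])
       (auto intro!: derivative_eq_intros)
  from has_derivative_mult_right[OF this, of "1 / of_real ((2 * pi) ^ DIM('a))"] show ?thesis
    unfolding wigner_eq_cross_wigner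
    by (simp add: sum_distrib_left sum.distrib distrib_left mult_ac)
qed

lemma pdiff_eqI:
  assumes "(f has_derivative D) (at x)" shows "pdiff b f x = D b"
  using frechet_derivative_at[OF assms] by (simp add: pdiff_def)

text \<open>Multiplication by \<open>p\<^sub>b\<close> differentiates once more, and the mixed terms \<open>w[\<partial>\<^sub>b f, \<partial>\<^sub>b g]\<close> cancel.\<close>

lemma free_transport_wigner:
  fixes f g :: "'a::euclidean_space \<Rightarrow> complex"
  assumes f: "Cinf_decaying f" and g: "Cinf_decaying g"
  shows "(\<Sum>b\<in>Basis. of_real (p \<bullet> b) * pdiff b (\<lambda>z. wigner f g z p) x)
    = \<i> / 2 * (wigner (laplacian f) g x p - wigner f (laplacian g) x p)"
proof -
  let ?k = "1 / complex_of_real ((2 * pi) ^ DIM('a))"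
  note n = Cinf_decaying_C1_decaying Cinf_decaying_cont_decaying f g Cinf_decaying_pdiff
  have "of_real (p \<bullet> b) * pdiff b (\<lambda>z. wigner f g z p) x
     = ?k * (\<i> / 2 * (cross_wigner (pdiff b (pdiff b f)) g p x x - cross_wigner f (pdiff b (pdiff b g)) p x x))"
    if b: "b \<in> Basis" for b
  proof -
    have "pdiff b (\<lambda>z. wigner f g z p) x = wigner (pdiff b f) g x p + wigner f (pdiff b g) x p"
      using sum_Basis_single[OF b, of 1 "\<lambda>b. wigner (pdiff b f) g x p + wigner f (pdiff b g) x p"]
        pdiff_eqI[OF has_derivative_wigner[OF Cinf_decaying_C1_decaying[OF f] Cinf_decaying_C1_decaying[OF g]], of b p x] by simp
    also have "\<dots> = ?k * (cross_wigner (pdiff b f) g p x x + cross_wigner f (pdiff b g) p x x)"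
      by (simp add: wigner_eq_cross_wigner algebra_simps)
    finally have "of_real (p \<bullet> b) * pdiff b (\<lambda>z. wigner f g z p) x
      = ?k * (of_real (p \<bullet> b) * cross_wigner (pdiff b f) g p x x + of_real (p \<bullet> b) * cross_wigner f (pdiff b g) p x x)"
      by (simp add: algebra_simps)
    also have "of_real (p \<bullet> b) * cross_wigner (pdiff b f) g p x x
        = \<i> / 2 * (cross_wigner (pdiff b (pdiff b f)) g p x x - cross_wigner (pdiff b f) (pdiff b g) p x x)"
      by (rule cross_wigner_by_parts) (intro n b)+
    also have "of_real (p \<bullet> b) * cross_wigner f (pdiff b g) p x x
        = \<i> / 2 * (cross_wigner (pdiff b f) (pdiff b g) p x x - cross_wigner f (pdiff b (pdiff b g)) p x x)"
      by (rule cross_wigner_by_parts) (intro n b)+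
    finally show ?thesis
      by (simp add: algebra_simps)
  qed
  then have "(\<Sum>b\<in>Basis. of_real (p \<bullet> b) * pdiff b (\<lambda>z. wigner f g z p) x)
     = ?k * (\<i> / 2 * ((\<Sum>b\<in>Basis. cross_wigner (pdiff b (pdiff b f)) g p x x) - (\<Sum>b\<in>Basis. cross_wigner f (pdiff b (pdiff b g)) p x x)))"
    by (simp add: sum_distrib_left sum_subtractf right_diff_distrib)
  also have "(\<Sum>b\<in>Basis. cross_wigner (pdiff b (pdiff b f)) g p x x) = cross_wigner (laplacian f) g p x x"
    unfolding laplacian_def[abs_def] by (rule cross_wigner_sum_left[symmetric]) (intro n)+
  also have "(\<Sum>b\<in>Basis. cross_wigner f (pdiff b (pdiff b g)) p x x) = cross_wigner f (laplacian g) p x x"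
    unfolding laplacian_def[abs_def] by (rule cross_wigner_sum_right[symmetric]) (intro n)+
  finally show ?thesis
    by (simp add: wigner_eq_cross_wigner algebra_simps)
qed

lemma integrable_wigner:
  assumes f: "Cinf_decaying f" and g: "Cinf_decaying g"
  shows "integrable lborel (wigner f g x)"
  unfolding wigner_eq_cross_wigner[abs_def] by (intro integrable_mult_right integrable_cross_wigner f g)

lemma wigner_inversion:
  assumes f: "Cinf_decaying f" and g: "Cinf_decaying g"
  shows "(\<integral>p. exp (- (\<i> * of_real (y \<bullet> p))) * wigner f g x p \<partial>lborel) = cnj (f (x + y /\<^sub>R 2)) * g (x - y /\<^sub>R 2)"
    (is "?L = ?R")
proof -
  let ?k = "1 / complex_of_real ((2 * pi) ^ DIM('a))"
  have "?L = (\<integral>p. ?k * (exp (- (\<i> * of_real (y \<bullet> p))) * cross_wigner f g p x x) \<partial>lborel)"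
    by (intro Bochner_Integration.integral_cong) (simp_all add: wigner_eq_cross_wigner)
  also have "\<dots> = ?k * (of_real ((2 * pi) ^ DIM('a)) * ?R)"
    unfolding cross_wigner_inversion[OF f g, symmetric] by (rule integral_mult_right_zero)
  also have "\<dots> = ?R"
    by simp
  finally show ?thesis .
qed

lemma
  assumes f: "Cinf_decaying f" and g: "Cinf_decaying g"
  shows phase_integrable_wigner: "phase_integrable (wigner f g)"
    and phase_integral_wigner: "phase_integral (wigner f g) = l2_inner f g"
proof -
  have 1: "(\<integral>p. wigner f g x p \<partial>lborel) = cnj (f x) * g x" for x
    using wigner_inversion[OF f g, of 0 x] by simp
  show "phase_integral (wigner f g) = l2_inner f g"
    by (simp add: phase_integral_def l2_inner_def 1)
  show "phase_integrable (wigner f g)"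
    unfolding phase_integrable_def 1
    using integrable_wigner[OF f g] integrable_decaying_prod[OF Cinf_decaying_cont_decaying[OF f] Cinf_decaying_cont_decaying[OF g]] by blast
qed

lemma cnj_l2_inner: "cnj (l2_inner f g) = l2_inner g f"
  unfolding l2_inner_def by (subst Bochner_Integration.integral_cnj[symmetric]) (simp add: mult.commute)

lemma cnj_wigner:
  "cont_decaying f \<Longrightarrow> cont_decaying g \<Longrightarrow> cnj (wigner f g x p) = wigner g f x p"
  by (simp add: wigner_eq_cross_wigner cnj_cross_wigner)

text \<open>By inversion, the integral over \<open>p'\<close> recovers \<open>cnj (f (x + y/2)) g (x - y/2)\<close>, and the two values of the
  potential are absorbed into \<open>f\<close> and \<open>g\<close>, whose products with \<open>V\<close> make the remaining integral over
  \<open>y\<close> converge.\<close>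

lemma
  fixes f g :: "'a::euclidean_space \<Rightarrow> complex" and V :: "'a \<Rightarrow> real"
  assumes f: "Cinf_decaying f" and g: "Cinf_decaying g"
    and Vf: "cont_decaying (\<lambda>x. of_real (V x) * f x)" and Vg: "cont_decaying (\<lambda>x. of_real (V x) * g x)"
  shows integrable_Theta_integrand_wigner: "integrable lborel (Theta_integrand V (wigner f g) x p y)"
    and integrable_Theta_wigner: "integrable lborel (\<lambda>y. \<integral>p'. Theta_integrand V (wigner f g) x p y p' \<partial>lborel)"
    and Theta_wigner: "Theta V (wigner f g) x p
      = - \<i> * (wigner (\<lambda>x. of_real (V x) * f x) g x p - wigner f (\<lambda>x. of_real (V x) * g x) x p)"
proof -
  let ?f = "\<lambda>x. of_real (V x) * f x" and ?g = "\<lambda>x. of_real (V x) * g x"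
  let ?v = "\<lambda>y. complex_of_real (V (x + y /\<^sub>R 2) - V (x - y /\<^sub>R 2))"
  have T: "Theta_integrand V (wigner f g) x p y p'
    = (exp (\<i> * of_real (y \<bullet> p)) * ?v y) * (exp (- (\<i> * of_real (y \<bullet> p'))) * wigner f g x p')" for y p'
  proof -
    have "exp (\<i> * of_real ((p - p') \<bullet> y)) = exp (\<i> * of_real (y \<bullet> p)) * exp (- (\<i> * of_real (y \<bullet> p')))"
      unfolding exp_add[symmetric] inner_commute[of "p - p'"]
      by (simp add: inner_diff_right right_diff_distrib)
    then show ?thesis unfolding Theta_integrand_def by (simp only: mult_ac)
  qed
  show "integrable lborel (Theta_integrand V (wigner f g) x p y)" for y
  proof -
    have "integrable lborel (\<lambda>p'. exp (- (\<i> * of_real (y \<bullet> p'))) * wigner f g x p')"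
      by (rule Bochner_Integration.integrable_bound[OF integrable_wigner[OF f g, of x]])
         (use integrable_wigner[OF f g, of x] in \<open>auto simp: norm_mult\<close>)
    then show ?thesis
      unfolding T[abs_def] by (rule integrable_mult_right)
  qed
  have I: "(\<integral>p'. Theta_integrand V (wigner f g) x p y p' \<partial>lborel) = wigner_integrand ?f g p x x y - wigner_integrand f ?g p x x y" for y
    unfolding T integral_mult_right_zero wigner_inversion[OF f g]
    by (simp add: wigner_integrand_def algebra_simps)
  note c = Cinf_decaying_cont_decaying[OF f] Cinf_decaying_cont_decaying[OF g] Vf Vg
  show "integrable lborel (\<lambda>y. \<integral>p'. Theta_integrand V (wigner f g) x p y p' \<partial>lborel)"
    unfolding I by (intro Bochner_Integration.integrable_diff integrable_wigner_integrand c)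
  have "(\<integral>y. \<integral>p'. Theta_integrand V (wigner f g) x p y p' \<partial>lborel \<partial>lborel) = cross_wigner ?f g p x x - cross_wigner f ?g p x x"
    unfolding I cross_wigner_def by (intro Bochner_Integration.integral_diff integrable_wigner_integrand c)
  then have "Theta V (wigner f g) x p
     = - (\<i> / of_real ((2 * pi) ^ DIM('a))) * (cross_wigner ?f g p x x - cross_wigner f ?g p x x)"
    unfolding Theta_def by (simp only:)
  also have "\<dots> = - \<i> * (wigner ?f g x p - wigner f ?g x p)"
    by (simp add: wigner_eq_cross_wigner algebra_simps)
  finally show "Theta V (wigner f g) x p = - \<i> * (wigner ?f g x p - wigner f ?g x p)" .
qed

section \<open>Smooth solutions at a fixed time\<close>

lemma smooth_on_differentiable:
  assumes "smooth_on S F" "open S" "z \<in> S"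
  shows "F differentiable (at z)"
proof -
  have "Ck_on (Suc 0) S F"
    using assms(1) unfolding smooth_on_def by blast
  then have "F differentiable (at z within S)"
    using assms(3) unfolding differentiable_on_def Ck_on.simps by blast
  then show ?thesis
    using at_within_open[OF assms(3,2)] by simp
qed

lemma smooth_on_pdiff:
  assumes "smooth_on S F" "b \<in> Basis" shows "smooth_on S (pdiff b F)"
  unfolding smooth_on_def
proof
  fix n show "Ck_on n S (pdiff b F)"
    using assms(1)[unfolded smooth_on_def, rule_format, of "Suc n"] assms(2) by simp
qed

lemma smooth_on_foldr_pdiff:
  assumes "smooth_on S F" "set bs \<subseteq> Basis" shows "smooth_on S (foldr pdiff bs F)"
  using assms(2) by (induction bs) (auto intro: assms smooth_on_pdiff)

lemma
  fixes F :: "real \<times> 'a::euclidean_space \<Rightarrow> complex"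
  assumes "F differentiable (at (t, x))"
  shows differentiable_slice: "(\<lambda>x. F (t, x)) differentiable (at x)"
    and pdiff_slice: "pdiff b (\<lambda>x. F (t, x)) x = pdiff (0, b) F (t, x)"
    and has_vector_derivative_slice: "((\<lambda>s. F (s, x)) has_vector_derivative pdiff (1, 0) F (t, x)) (at t)"
proof -
  have D: "(F has_derivative frechet_derivative F (at (t, x))) (at (t, x))"
    using assms by (rule frechet_derivative_works[THEN iffD1])
  have 1: "((\<lambda>x. F (t, x)) has_derivative (\<lambda>h. frechet_derivative F (at (t, x)) (0, h))) (at x)"
    by (rule has_derivative_compose[where f="Pair t" and f'="Pair 0", OF _ D]) (auto intro!: derivative_eq_intros)
  then show "(\<lambda>x. F (t, x)) differentiable (at x)"
    unfolding differentiable_def by blast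
  show "pdiff b (\<lambda>x. F (t, x)) x = pdiff (0, b) F (t, x)"
    using pdiff_eqI[OF 1, of b] by (simp add: pdiff_def)
  have 2: "((\<lambda>s. F (s, x)) has_derivative (\<lambda>h. frechet_derivative F (at (t, x)) (h, 0))) (at t)"
    by (rule has_derivative_compose[where f="\<lambda>s. (s, x)" and f'="\<lambda>h. (h, 0)", OF _ D]) (auto intro!: derivative_eq_intros)
  have "frechet_derivative F (at (t, x)) (h, 0) = h *\<^sub>R pdiff (1, 0) F (t, x)" for h
    using linear_scale[OF has_derivative_linear[OF D], of h "(1, 0)"] by (simp add: pdiff_def)
  with 2 show "((\<lambda>s. F (s, x)) has_vector_derivative pdiff (1, 0) F (t, x)) (at t)"
    unfolding has_vector_derivative_def by simp
qed

lemma decays_decaying: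
  assumes "decays f" "t > 0" shows "decaying (f t)"
  using assms(1)[unfolded decays_def, rule_format, of t t] assms(2) unfolding decaying_def by auto

text \<open>The majorant is a decaying function of \<open>x\<close> alone, so that bounds at a fixed time carry over to a time
  interval.\<close>

lemma decays_majorant:
  fixes f :: "real \<Rightarrow> 'a::euclidean_space \<Rightarrow> complex"
  assumes "decays f" "0 < a" "a \<le> b"
  obtains M :: "'a \<Rightarrow> complex" where "decaying M" "\<And>t x. t \<in> {a..b} \<Longrightarrow> norm (f t x) \<le> norm (M x)"
proof -
  obtain m C where mC: "m > real DIM('a) / 2" "\<And>t x. t \<in> {a..b} \<Longrightarrow> norm (f t x) \<le> C * (1 + norm x) powr (- m)"
    using assms unfolding decays_def by blast
  let ?M = "\<lambda>x::'a. complex_of_real (C * (1 + norm x) powr (- m))"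
  have "decaying ?M"
    by (rule decayingI[OF mC(1), of _ "\<bar>C\<bar>"]) (simp add: norm_mult)
  moreover have "norm (f t x) \<le> norm (?M x)" if "t \<in> {a..b}" for t x
    unfolding norm_of_real using mC(2)[OF that, of x] by simp
  ultimately show ?thesis by (rule that)
qed

abbreviation dtime :: "(real \<Rightarrow> 'a::euclidean_space \<Rightarrow> complex) \<Rightarrow> real \<Rightarrow> 'a \<Rightarrow> complex" where
  "dtime \<psi> \<equiv> \<lambda>t x. time_deriv (\<lambda>s. \<psi> s x) t"

lemma
  fixes \<psi> :: "real \<Rightarrow> 'a::euclidean_space \<Rightarrow> complex"
  assumes sd: "smooth_decaying \<psi>" and t: "t > 0"
  shows smooth_decaying_Cinf_decaying: "Cinf_decaying (\<psi> t)"
    and smooth_decaying_has_time_deriv: "((\<lambda>s. \<psi> s x) has_vector_derivative dtime \<psi> t x) (at t)"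
    and smooth_decaying_cont_decaying_dtime: "cont_decaying (dtime \<psi> t)"
proof -
  let ?S = "{0<..} \<times> UNIV :: (real \<times> 'a) set"
  define F where "F = (\<lambda>(t, x). \<psi> t x)"
  have F: "F (t, x) = \<psi> t x" for t x by (simp add: F_def)
  have S: "open ?S" by (intro open_Times) auto
  have sm: "smooth_on ?S F"
    and dt: "decays (dtime \<psi>)" and dx: "\<And>bs. set bs \<subseteq> Basis \<Longrightarrow> decays (\<lambda>t. foldr pdiff bs (\<psi> t))"
    using sd unfolding smooth_decaying_def F_def by auto
  have B: "(0, b) \<in> Basis" if "b \<in> (Basis :: 'a set)" for b
    using that by (simp add: Basis_prod_def)
  have in_S: "(t, x) \<in> ?S" for x using t by simp
  \<comment> \<open>Space derivatives at fixed time are partial derivatives on space-time in the directions \<open>(0, b)\<close>.\<close>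
  have fold: "foldr pdiff bs (\<psi> t) = (\<lambda>x. foldr pdiff (map (Pair 0) bs) F (t, x))" if "set bs \<subseteq> Basis" for bs
    using that
  proof (induction bs)
    case Nil then show ?case by (simp add: F)
  next
    case (Cons b bs)
    have "smooth_on ?S (foldr pdiff (map (Pair 0) bs) F)"
      by (rule smooth_on_foldr_pdiff[OF sm]) (use Cons.prems B in auto)
    from pdiff_slice[OF smooth_on_differentiable[OF this S in_S]]
    show ?case using Cons by simp
  qed
  show "Cinf_decaying (\<psi> t)"
    unfolding Cinf_decaying_def
  proof (intro allI impI conjI)
    fix bs :: "'a list" and x assume bs: "set bs \<subseteq> Basis"
    have "smooth_on ?S (foldr pdiff (map (Pair 0) bs) F)"
      by (rule smooth_on_foldr_pdiff[OF sm]) (use bs B in auto)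
    from differentiable_slice[OF smooth_on_differentiable[OF this S in_S]]
    show "foldr pdiff bs (\<psi> t) differentiable (at x)"
      unfolding fold[OF bs] .
    show "decaying (foldr pdiff bs (\<psi> t))"
      by (rule decays_decaying[OF dx[OF bs] t])
  qed
  have vd: "((\<lambda>s. \<psi> s x) has_vector_derivative pdiff (1, 0) F (t, x)) (at t)" for x
    using has_vector_derivative_slice[OF smooth_on_differentiable[OF sm S in_S]] by (simp add: F)
  then have td: "dtime \<psi> t = (\<lambda>x. pdiff (1, 0) F (t, x))"
    unfolding time_deriv_def fun_eq_iff by (auto intro: vector_derivative_at)
  show "((\<lambda>s. \<psi> s x) has_vector_derivative dtime \<psi> t x) (at t)"
    using vd[of x] td[THEN fun_cong, of x] by simp
  have "smooth_on ?S (pdiff (1, 0) F)"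
    by (rule smooth_on_pdiff[OF sm]) (simp add: Basis_prod_def)
  from differentiable_slice[OF smooth_on_differentiable[OF this S in_S]]
  have "continuous_on UNIV (dtime \<psi> t)"
    unfolding td by (auto intro!: continuous_at_imp_continuous_on differentiable_imp_continuous_within)
  then show "cont_decaying (dtime \<psi> t)"
    unfolding cont_decaying_def using decays_decaying[OF dt t] by blast
qed

section \<open>Time derivative of the Wigner transform\<close>

lemma has_vector_derivative_wigner:
  fixes \<psi> \<phi> :: "real \<Rightarrow> 'a::euclidean_space \<Rightarrow> complex"
  assumes \<psi>: "smooth_decaying \<psi>" and \<phi>: "smooth_decaying \<phi>" and t: "t > 0"
  shows "((\<lambda>s. wigner (\<psi> s) (\<phi> s) x p) has_vector_derivative
     wigner (dtime \<psi> t) (\<phi> t) x p + wigner (\<psi> t) (dtime \<phi> t) x p) (at t)"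
proof -
  have ex: "\<exists>M :: 'a \<Rightarrow> complex. decaying M \<and> (\<forall>s\<in>{t/2..3*t/2}. \<forall>x. norm (\<psi> s x) + norm (dtime \<psi> s x) \<le> norm (M x))"
    if \<psi>: "smooth_decaying \<psi>" for \<psi> :: "real \<Rightarrow> 'a \<Rightarrow> complex"
  proof -
    have d: "decays \<psi>" "decays (dtime \<psi>)"
      using \<psi> unfolding smooth_decaying_def by (auto dest: spec[of _ "[]"])
    obtain M1 :: "'a \<Rightarrow> complex" where M1: "decaying M1" "\<And>s x. s \<in> {t/2..3*t/2} \<Longrightarrow> norm (\<psi> s x) \<le> norm (M1 x)"
      using decays_majorant[OF d(1), of "t/2" "3*t/2"] t by auto
    obtain M2 :: "'a \<Rightarrow> complex" where M2: "decaying M2" "\<And>s x. s \<in> {t/2..3*t/2} \<Longrightarrow> norm (dtime \<psi> s x) \<le> norm (M2 x)"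
      using decays_majorant[OF d(2), of "t/2" "3*t/2"] t by auto
    have n: "norm (complex_of_real (norm (M1 x)) + of_real (norm (M2 x))) = norm (M1 x) + norm (M2 x)" for x
      by (simp only: of_real_add[symmetric] norm_of_real) simp
    have "decaying (\<lambda>x. complex_of_real (norm (M1 x)) + of_real (norm (M2 x)))"
      by (intro decaying_add decaying_norm M1 M2)
    with M1(2) M2(2) show ?thesis
      by (intro exI[of _ "\<lambda>x. complex_of_real (norm (M1 x)) + of_real (norm (M2 x))"]) (auto simp: n intro: add_mono)
  qed
  obtain M1 :: "'a \<Rightarrow> complex" where M1: "decaying M1"
    "\<And>s x. s \<in> {t/2..3*t/2} \<Longrightarrow> norm (\<psi> s x) + norm (dtime \<psi> s x) \<le> norm (M1 x)"
    using ex[OF \<psi>] by auto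
  obtain M2 :: "'a \<Rightarrow> complex" where M2: "decaying M2"
    "\<And>s x. s \<in> {t/2..3*t/2} \<Longrightarrow> norm (\<phi> s x) + norm (dtime \<phi> s x) \<le> norm (M2 x)"
    using ex[OF \<phi>] by auto
  obtain G :: "'a \<Rightarrow> real" where G: "integrable lborel G"
    "\<And>a c y. norm a \<le> norm x \<Longrightarrow> norm c \<le> norm x \<Longrightarrow> norm (M1 (a + y /\<^sub>R 2)) * norm (M2 (c - y /\<^sub>R 2)) \<le> G y"
    using ex_wigner_integrand_bound[OF M1(1) M2(1)] by blast
  have pos: "s > 0" and Icc: "s \<in> {t/2..3*t/2}" if "s \<in> ball t (t/2)" for s
    using that by (auto simp: dist_real_def abs_if split: if_splits)
  let ?d = "\<lambda>s y. wigner_integrand (dtime \<psi> s) (\<phi> s) p x x y + wigner_integrand (\<psi> s) (dtime \<phi> s) p x x y"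
  note c = smooth_decaying_Cinf_decaying[OF \<psi>, THEN Cinf_decaying_cont_decaying] smooth_decaying_Cinf_decaying[OF \<phi>, THEN Cinf_decaying_cont_decaying]
    smooth_decaying_cont_decaying_dtime[OF \<psi>] smooth_decaying_cont_decaying_dtime[OF \<phi>]
  have "((\<lambda>s. \<integral>y. wigner_integrand (\<psi> s) (\<phi> s) p x x y \<partial>lborel) has_derivative (\<lambda>h. \<integral>y. h *\<^sub>R ?d t y \<partial>lborel)) (at t)"
  proof (rule has_derivative_integral_dominated[where r="t/2" and g=G and f'="\<lambda>s h y. h *\<^sub>R ?d s y"])
    show "integrable lborel (wigner_integrand (\<psi> s) (\<phi> s) p x x)" if "s \<in> ball t (t/2)" for s
      by (intro integrable_wigner_integrand c pos[OF that])
    show "(\<lambda>y. h *\<^sub>R ?d t y) \<in> borel_measurable lborel" for h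
      by (intro borel_measurable_scaleR borel_measurable_add borel_measurable_const borel_measurable_integrable[OF integrable_wigner_integrand] c t)
    show "((\<lambda>s. wigner_integrand (\<psi> s) (\<phi> s) p x x y) has_derivative (\<lambda>h. h *\<^sub>R ?d s y)) (at s)"
      if s: "s \<in> ball t (t/2)" for s y
    proof -
      note v = smooth_decaying_has_time_deriv[OF \<psi> pos[OF s], of "x + y /\<^sub>R 2"]
        smooth_decaying_has_time_deriv[OF \<phi> pos[OF s], of "x - y /\<^sub>R 2"]
      have "((\<lambda>s. exp (\<i> * of_real (y \<bullet> p)) * (cnj (\<psi> s (x + y /\<^sub>R 2)) * \<phi> s (x - y /\<^sub>R 2))) has_vector_derivative
         exp (\<i> * of_real (y \<bullet> p)) * (cnj (\<psi> s (x + y /\<^sub>R 2)) * dtime \<phi> s (x - y /\<^sub>R 2)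
           + cnj (dtime \<psi> s (x + y /\<^sub>R 2)) * \<phi> s (x - y /\<^sub>R 2))) (at s)"
        by (intro has_vector_derivative_mult_right has_vector_derivative_mult has_vector_derivative_cnj v)
      then have "((\<lambda>s. wigner_integrand (\<psi> s) (\<phi> s) p x x y) has_vector_derivative ?d s y) (at s)"
        by (simp add: wigner_integrand_def algebra_simps)
      then show ?thesis unfolding has_vector_derivative_def .
    qed
    show "norm (h *\<^sub>R ?d s y) \<le> G y * norm h" if s: "s \<in> ball t (t/2)" for s h y
    proof -
      let ?u = "x + y /\<^sub>R 2" and ?v = "x - y /\<^sub>R 2"
      have "norm (?d s y) \<le> norm (dtime \<psi> s ?u) * norm (\<phi> s ?v) + norm (\<psi> s ?u) * norm (dtime \<phi> s ?v)"
        by (rule norm_triangle_le) (simp add: norm_wigner_integrand)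
      also have "\<dots> \<le> (norm (\<psi> s ?u) + norm (dtime \<psi> s ?u)) * (norm (\<phi> s ?v) + norm (dtime \<phi> s ?v))"
        by (simp add: algebra_simps)
      also have "\<dots> \<le> norm (M1 ?u) * norm (M2 ?v)"
        by (intro mult_mono M1 M2 Icc[OF s]) auto
      also have "\<dots> \<le> G y"
        by (rule G(2)) auto
      finally show ?thesis
        unfolding norm_scaleR by (subst mult.commute) (auto intro: mult_right_mono)
    qed
  qed (use t G in auto)
  then have "((\<lambda>s. cross_wigner (\<psi> s) (\<phi> s) p x x) has_vector_derivative (\<integral>y. ?d t y \<partial>lborel)) (at t)"
    unfolding has_vector_derivative_def cross_wigner_def by simp
  also have "(\<integral>y. ?d t y \<partial>lborel) = cross_wigner (dtime \<psi> t) (\<phi> t) p x x + cross_wigner (\<psi> t) (dtime \<phi> t) p x x"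
    unfolding cross_wigner_def by (intro Bochner_Integration.integral_add integrable_wigner_integrand c t)
  finally show ?thesis
    unfolding wigner_eq_cross_wigner distrib_left[symmetric] by (rule has_vector_derivative_mult_right)
qed

section \<open>Linearity\<close>

lemma
  fixes w1 w2 :: "'a::euclidean_space \<Rightarrow> 'a \<Rightarrow> complex"
  assumes 1: "phase_integrable w1" and 2: "phase_integrable w2"
  shows phase_integrable_lincomb: "phase_integrable (\<lambda>x p. \<alpha> * w1 x p + \<beta> * w2 x p)"
    and phase_integral_lincomb: "phase_integral (\<lambda>x p. \<alpha> * w1 x p + \<beta> * w2 x p)
      = \<alpha> * phase_integral w1 + \<beta> * phase_integral w2"
proof -
  note i = 1[unfolded phase_integrable_def] 2[unfolded phase_integrable_def]
  have p: "(\<integral>p. \<alpha> * w1 x p + \<beta> * w2 x p \<partial>lborel) = \<alpha> * (\<integral>p. w1 x p \<partial>lborel) + \<beta> * (\<integral>p. w2 x p \<partial>lborel)" for x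
    using i by simp
  show "phase_integrable (\<lambda>x p. \<alpha> * w1 x p + \<beta> * w2 x p)"
    unfolding phase_integrable_def p using i by simp
  show "phase_integral (\<lambda>x p. \<alpha> * w1 x p + \<beta> * w2 x p) = \<alpha> * phase_integral w1 + \<beta> * phase_integral w2"
    unfolding phase_integral_def p using i by simp
qed

lemma
  fixes w1 w2 :: "real \<Rightarrow> 'a::euclidean_space \<Rightarrow> 'a \<Rightarrow> complex"
  assumes 1: "transport_exists V w1 t x p" and 2: "transport_exists V w2 t x p"
  shows transport_exists_lincomb: "transport_exists V (\<lambda>t x p. \<alpha> * w1 t x p + \<beta> * w2 t x p) t x p"
    and transport_lincomb: "transport V (\<lambda>t x p. \<alpha> * w1 t x p + \<beta> * w2 t x p) t x p
      = \<alpha> * transport V w1 t x p + \<beta> * transport V w2 t x p"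
proof -
  let ?w = "\<lambda>t x p. \<alpha> * w1 t x p + \<beta> * w2 t x p"
  note e = 1[unfolded transport_exists_def] 2[unfolded transport_exists_def]
  have T: "Theta_integrand V (?w t) x p y = (\<lambda>p'. \<alpha> * Theta_integrand V (w1 t) x p y p' + \<beta> * Theta_integrand V (w2 t) x p y p')" for y
    by (simp add: Theta_integrand_def fun_eq_iff algebra_simps)
  have I: "(\<integral>p'. Theta_integrand V (?w t) x p y p' \<partial>lborel)
    = \<alpha> * (\<integral>p'. Theta_integrand V (w1 t) x p y p' \<partial>lborel) + \<beta> * (\<integral>p'. Theta_integrand V (w2 t) x p y p' \<partial>lborel)" for y
    unfolding T using e by simp
  show "transport_exists V ?w t x p"
    unfolding transport_exists_def I
    unfolding T using e by (auto intro!: derivative_intros Bochner_Integration.integrable_add)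
  have th: "Theta V (?w t) x p = \<alpha> * Theta V (w1 t) x p + \<beta> * Theta V (w2 t) x p"
    unfolding Theta_def I using e by (simp add: algebra_simps)
  have ti: "time_deriv (\<lambda>s. ?w s x p) t = \<alpha> * time_deriv (\<lambda>s. w1 s x p) t + \<beta> * time_deriv (\<lambda>s. w2 s x p) t"
    unfolding time_deriv_def
    by (rule vector_derivative_at)
       (use e in \<open>intro has_vector_derivative_add has_vector_derivative_mult_right
          vector_derivative_works[THEN iffD1]; blast\<close>)
  have sp: "pdiff b (\<lambda>z. ?w t z p) x = \<alpha> * pdiff b (\<lambda>z. w1 t z p) x + \<beta> * pdiff b (\<lambda>z. w2 t z p) x" for b
    unfolding pdiff_def[of b "\<lambda>z. w1 t z p"] pdiff_def[of b "\<lambda>z. w2 t z p"]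
    by (rule pdiff_eqI)
       (use e in \<open>intro has_derivative_add has_derivative_mult_right
          frechet_derivative_works[THEN iffD1]; blast\<close>)
  show "transport V ?w t x p = \<alpha> * transport V w1 t x p + \<beta> * transport V w2 t x p"
    unfolding transport_def th ti sp
    by (simp add: sum.distrib sum_distrib_left algebra_simps)
qed

lemma wigner_linear_left:
  fixes g :: "'a::euclidean_space \<Rightarrow> complex"
  assumes "cont_decaying g" "cont_decaying L" "cont_decaying U" "cont_decaying f" "\<And>l. l \<in> A \<Longrightarrow> cont_decaying (F l)"
  shows "wigner (\<lambda>x. a * L x + b * U x + k * (\<Sum>l\<in>A. F l x - c l * f x)) g x p
    = cnj a * wigner L g x p + cnj b * wigner U g x p
      + cnj k * (\<Sum>l\<in>A. wigner (F l) g x p - cnj (c l) * wigner f g x p)"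
proof -
  have "cross_wigner (\<lambda>x. a * L x + b * U x + k * (\<Sum>l\<in>A. F l x - c l * f x)) g p x x
    = cnj a * cross_wigner L g p x x + cnj b * cross_wigner U g p x x
      + cnj k * (\<Sum>l\<in>A. cross_wigner (F l) g p x x - cnj (c l) * cross_wigner f g p x x)"
    using assms by (simp add: cross_wigner_add_left cross_wigner_cmult_left cross_wigner_sum_left cross_wigner_diff_left cont_decaying_add cont_decaying_cmult cont_decaying_sum cont_decaying_diff)
  moreover define d where "d = 1 / complex_of_real ((2 * pi) ^ DIM('a))"
  moreover have "(\<Sum>l\<in>A. d * cross_wigner (F l) g p x x - cnj (c l) * (d * cross_wigner f g p x x))
    = d * (\<Sum>l\<in>A. cross_wigner (F l) g p x x - cnj (c l) * cross_wigner f g p x x)"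
    by (simp add: sum_distrib_left algebra_simps)
  ultimately show ?thesis
    unfolding wigner_eq_cross_wigner d_def[symmetric] by (simp only: distrib_left mult_ac)
qed

lemma wigner_linear_right:
  fixes g :: "'a::euclidean_space \<Rightarrow> complex"
  assumes "cont_decaying g" "cont_decaying L" "cont_decaying U" "cont_decaying f" "\<And>l. l \<in> A \<Longrightarrow> cont_decaying (F l)"
  shows "wigner g (\<lambda>x. a * L x + b * U x + k * (\<Sum>l\<in>A. F l x - c l * f x)) x p
    = a * wigner g L x p + b * wigner g U x p
      + k * (\<Sum>l\<in>A. wigner g (F l) x p - c l * wigner g f x p)"
proof -
  have "cross_wigner g (\<lambda>x. a * L x + b * U x + k * (\<Sum>l\<in>A. F l x - c l * f x)) p x x
    = a * cross_wigner g L p x x + b * cross_wigner g U p x x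
      + k * (\<Sum>l\<in>A. cross_wigner g (F l) p x x - c l * cross_wigner g f p x x)"
    using assms by (simp add: cross_wigner_add_right cross_wigner_cmult_right cross_wigner_sum_right cross_wigner_diff_right cont_decaying_add cont_decaying_cmult cont_decaying_sum cont_decaying_diff)
  moreover define d where "d = 1 / complex_of_real ((2 * pi) ^ DIM('a))"
  moreover have "(\<Sum>l\<in>A. d * cross_wigner g (F l) p x x - c l * (d * cross_wigner g f p x x))
    = d * (\<Sum>l\<in>A. cross_wigner g (F l) p x x - c l * cross_wigner g f p x x)"
    by (simp add: sum_distrib_left algebra_simps)
  ultimately show ?thesis
    unfolding wigner_eq_cross_wigner d_def[symmetric] by (simp only: distrib_left mult_ac)
qed

section \<open>The transport equation of the Wigner transforms\<close>

lemma cont_decaying_laplacian: "Cinf_decaying f \<Longrightarrow> cont_decaying (laplacian f)"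
  unfolding laplacian_def[abs_def] by (intro cont_decaying_sum Cinf_decaying_cont_decaying Cinf_decaying_pdiff)

context
  fixes N :: nat and K :: real
    and V :: "'a::euclidean_space \<Rightarrow> real"
    and \<psi> :: "nat \<Rightarrow> real \<Rightarrow> 'a \<Rightarrow> complex"
    and t :: real
  assumes sd: "\<forall>j\<in>{1..N}. smooth_decaying (\<psi> j)"
    and eq: "schroedinger_lohe N K V \<psi>"
    and t: "t > 0"
begin

private abbreviation "\<kappa> \<equiv> complex_of_real K / (2 * of_nat N)"

lemma Cinf_decaying_sol: "j \<in> {1..N} \<Longrightarrow> Cinf_decaying (\<psi> j t)"
  using sd t by (intro smooth_decaying_Cinf_decaying) auto

lemmas cont_decaying_sol = Cinf_decaying_sol[THEN Cinf_decaying_cont_decaying]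

lemma schroedinger_solved:
  assumes j: "j \<in> {1..N}"
  shows "dtime (\<psi> j) t x = \<i> / 2 * laplacian (\<psi> j t) x + (- \<i>) * (of_real (V x) * \<psi> j t x)
    + \<kappa> * (\<Sum>l=1..N. \<psi> l t x - l2_inner (\<psi> l t) (\<psi> j t) * \<psi> j t x)"
proof -
  have "\<i> * dtime (\<psi> j) t x =
          - (1/2) * laplacian (\<psi> j t) x + of_real (V x) * \<psi> j t x
          + \<i> * of_real K / (2 * of_nat N) *
            (\<Sum>k=1..N. \<psi> k t x - l2_inner (\<psi> k t) (\<psi> j t) * \<psi> j t x)" (is "_ = ?R")
    using eq j t unfolding schroedinger_lohe_def by blast
  then have "(- \<i>) * (\<i> * dtime (\<psi> j) t x) = (- \<i>) * ?R"
    by (rule arg_cong)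
  then have "dtime (\<psi> j) t x = (- \<i>) * ?R"
    by simp
  then show ?thesis
    by (simp add: algebra_simps)
qed

text \<open>The equation expresses \<open>V \<psi>\<^sub>j\<close> through functions that are continuous and decay, whatever the potential
  is.\<close>

lemma cont_decaying_potential:
  assumes j: "j \<in> {1..N}"
  shows "cont_decaying (\<lambda>x. of_real (V x) * \<psi> j t x)"
proof -
  let ?R = "\<lambda>x. \<i> * dtime (\<psi> j) t x + 1/2 * laplacian (\<psi> j t) x
     - \<i> * \<kappa> * (\<Sum>l=1..N. \<psi> l t x - l2_inner (\<psi> l t) (\<psi> j t) * \<psi> j t x)"
  have "cont_decaying ?R"
    using j sd t
    by (intro cont_decaying_add cont_decaying_diff cont_decaying_cmult cont_decaying_sum cont_decaying_laplacian Cinf_decaying_sol cont_decaying_sol smooth_decaying_cont_decaying_dtime) auto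
  moreover have "?R = (\<lambda>x. of_real (V x) * \<psi> j t x)"
    unfolding schroedinger_solved[OF j] by (simp add: fun_eq_iff algebra_simps)
  ultimately show ?thesis by simp
qed

lemma transport_exists_W:
  assumes j: "j \<in> {1..N}" and k: "k \<in> {1..N}"
  shows "transport_exists V (W \<psi> j k) t x p"
  unfolding transport_exists_def W_def
proof (intro conjI allI)
  show "(\<lambda>s. wigner (\<psi> j s) (\<psi> k s) x p) differentiable at t"
    using has_vector_derivative_wigner[of "\<psi> j" "\<psi> k" t x p] sd j k t differentiableI_vector by blast
  show "(\<lambda>z. wigner (\<psi> j t) (\<psi> k t) z p) differentiable at x"
    using has_derivative_wigner[OF Cinf_decaying_C1_decaying Cinf_decaying_C1_decaying, OF Cinf_decaying_sol[OF j] Cinf_decaying_sol[OF k]]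
    unfolding differentiable_def by blast
qed (intro integrable_Theta_integrand_wigner integrable_Theta_wigner Cinf_decaying_sol cont_decaying_potential j k)+

text \<open>The terms with \<open>\<Delta>\<close> cancel against the free transport and those with \<open>V\<close> against \<open>\<Theta>[V]\<close>; the coupling
  constant is real, so the coupling terms of both factors add up.\<close>

lemma transport_W:
  assumes j: "j \<in> {1..N}" and k: "k \<in> {1..N}"
  shows "transport V (W \<psi> j k) t x p = \<kappa> * (\<Sum>l=1..N. W \<psi> l k t x p + W \<psi> j l t x p
    - (l2_inner (\<psi> j t) (\<psi> l t) + l2_inner (\<psi> l t) (\<psi> k t)) * W \<psi> j k t x p)"
proof -
  note c = cont_decaying_laplacian Cinf_decaying_sol cont_decaying_sol cont_decaying_potential j k
  let ?w = "\<lambda>f g. wigner f g x p"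
  let ?f = "\<psi> j t" and ?g = "\<psi> k t"
  let ?Vf = "\<lambda>x. of_real (V x) * ?f x" and ?Vg = "\<lambda>x. of_real (V x) * ?g x"
  have "((\<lambda>s. W \<psi> j k s x p) has_vector_derivative ?w (dtime (\<psi> j) t) ?g + ?w ?f (dtime (\<psi> k) t)) (at t)"
    unfolding W_def by (rule has_vector_derivative_wigner) (use sd j k t in auto)
  then have time: "time_deriv (\<lambda>s. W \<psi> j k s x p) t = ?w (dtime (\<psi> j) t) ?g + ?w ?f (dtime (\<psi> k) t)"
    unfolding time_deriv_def[of "\<lambda>s. W \<psi> j k s x p"] by (rule vector_derivative_at)
  have left: "?w (dtime (\<psi> j) t) ?g = cnj (\<i> / 2) * ?w (laplacian ?f) ?g + cnj (- \<i>) * ?w ?Vf ?g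
      + cnj \<kappa> * (\<Sum>l=1..N. ?w (\<psi> l t) ?g - cnj (l2_inner (\<psi> l t) ?f) * ?w ?f ?g)"
    unfolding schroedinger_solved[OF j] by (intro wigner_linear_left c)
  have right: "?w ?f (dtime (\<psi> k) t) = \<i> / 2 * ?w ?f (laplacian ?g) + (- \<i>) * ?w ?f ?Vg
      + \<kappa> * (\<Sum>l=1..N. ?w ?f (\<psi> l t) - l2_inner (\<psi> l t) ?g * ?w ?f ?g)"
    unfolding schroedinger_solved[OF k] by (intro wigner_linear_right c)
  have space: "(\<Sum>b\<in>Basis. of_real (p \<bullet> b) * pdiff b (\<lambda>z. W \<psi> j k t z p) x)
    = \<i> / 2 * (?w (laplacian ?f) ?g - ?w ?f (laplacian ?g))"
    unfolding W_def by (intro free_transport_wigner Cinf_decaying_sol j k)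
  have theta: "Theta V (W \<psi> j k t) x p = - \<i> * (?w ?Vf ?g - ?w ?f ?Vg)"
    unfolding W_def by (intro Theta_wigner c)
  have "transport V (W \<psi> j k) t x p
    = \<kappa> * ((\<Sum>l=1..N. ?w (\<psi> l t) ?g - l2_inner ?f (\<psi> l t) * ?w ?f ?g)
         + (\<Sum>l=1..N. ?w ?f (\<psi> l t) - l2_inner (\<psi> l t) ?g * ?w ?f ?g))"
    unfolding transport_def time left right space theta cnj_l2_inner by (simp add: distrib_left right_diff_distrib)
  also have "\<dots> = \<kappa> * (\<Sum>l=1..N. W \<psi> l k t x p + W \<psi> j l t x p
    - (l2_inner (\<psi> j t) (\<psi> l t) + l2_inner (\<psi> l t) (\<psi> k t)) * W \<psi> j k t x p)"
    unfolding sum.distrib[symmetric] W_def by (intro arg_cong[where f="(*) \<kappa>"] sum.cong) (simp_all add: algebra_simps)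
  finally show ?thesis .
qed

end

section \<open>Real and imaginary parts\<close>

lemma Wplus_eq:
  assumes "cont_decaying (\<psi> j t)" "cont_decaying (\<psi> k t)"
  shows "Wplus \<psi> j k t x p = 1/2 * W \<psi> j k t x p + 1/2 * W \<psi> k j t x p"
  unfolding Wplus_def W_def cnj_wigner[OF assms, symmetric]
  by (simp add: complex_eq_iff)

lemma Wminus_eq:
  assumes "cont_decaying (\<psi> j t)" "cont_decaying (\<psi> k t)"
  shows "Wminus \<psi> j k t x p = - \<i>/2 * W \<psi> j k t x p + \<i>/2 * W \<psi> k j t x p"
  unfolding Wminus_def W_def cnj_wigner[OF assms, symmetric]
  by (simp add: complex_eq_iff)

text \<open>Only times near \<open>t\<close> matter. This allows the representation of \<open>Wplus\<close> and \<open>Wminus\<close> by \<open>W\<close>, which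
  requires decay and hence positive time, to be used under the time derivative.\<close>

lemma transport_cong:
  assumes "\<And>s x p. s > 0 \<Longrightarrow> w s x p = w' s x p" and t: "t > 0"
  shows "transport V w t x p = transport V w' t x p"
    and "transport_exists V w t x p = transport_exists V w' t x p"
proof -
  have ev: "\<forall>\<^sub>F s in nhds t. w s x p = w' s x p"
    using eventually_nhds_in_open[of "{0<..}" t] t assms(1) by (auto elim: eventually_mono)
  have wt: "w t = w' t" using assms by (simp add: fun_eq_iff)
  have hv: "((\<lambda>s. w s x p) has_vector_derivative D) (at t) \<longleftrightarrow> ((\<lambda>s. w' s x p) has_vector_derivative D) (at t)" for D
    by (rule has_vector_derivative_cong_ev) (use ev wt in \<open>auto elim: eventually_mono\<close>)
  show "transport V w t x p = transport V w' t x p"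
    unfolding transport_def time_deriv_def vector_derivative_def hv wt ..
  have "(\<lambda>s. w s x p) differentiable (at t) \<longleftrightarrow> (\<lambda>s. w' s x p) differentiable (at t)"
    by (metis hv differentiableI_vector vector_derivative_works)
  then show "transport_exists V w t x p = transport_exists V w' t x p"
    unfolding transport_exists_def wt by simp
qed

theorem mainTheorem1:
  fixes N :: nat and K :: real
    and V :: "'a::euclidean_space \<Rightarrow> real"
    and \<psi> :: "nat \<Rightarrow> real \<Rightarrow> 'a \<Rightarrow> complex"
  assumes "N \<ge> 1" and "K \<ge> 0"
    and "\<forall>j\<in>{1..N}. smooth_decaying (\<psi> j)"
    and "schroedinger_lohe N K V \<psi>"
    and "\<forall>j\<in>{1..N}. l2_norm (\<psi> j 0) = 1"
  shows "\<forall>j\<in>{1..N}. \<forall>k\<in>{1..N}. \<forall>t>0.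
    phase_integrable (Wplus \<psi> j k t) \<and> phase_integrable (Wminus \<psi> j k t) \<and>
    (\<forall>x p.
      transport_exists V (W \<psi> j j) t x p \<and>
      transport_exists V (Wplus \<psi> j k) t x p \<and>
      transport_exists V (Wminus \<psi> j k) t x p \<and>
      transport V (W \<psi> j j) t x p =
        of_real K / of_nat N *
        (\<Sum>l=1..N. Wplus \<psi> j l t x p - phase_integral (Wplus \<psi> j l t) * W \<psi> j j t x p) \<and>
      transport V (Wplus \<psi> j k) t x p =
        of_real K / (2 * of_nat N) *
        (\<Sum>l=1..N. Wplus \<psi> j l t x p + Wplus \<psi> l k t x p
          - phase_integral (\<lambda>x p. Wplus \<psi> j l t x p + Wplus \<psi> l k t x p) * Wplus \<psi> j k t x p
          + phase_integral (\<lambda>x p. Wminus \<psi> j l t x p + Wminus \<psi> l k t x p) * Wminus \<psi> j k t x p) \<and>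
      transport V (Wminus \<psi> j k) t x p =
        of_real K / (2 * of_nat N) *
        (\<Sum>l=1..N. Wminus \<psi> j l t x p + Wminus \<psi> l k t x p
          - phase_integral (\<lambda>x p. Wplus \<psi> j l t x p + Wplus \<psi> l k t x p) * Wminus \<psi> j k t x p
          - phase_integral (\<lambda>x p. Wminus \<psi> j l t x p + Wminus \<psi> l k t x p) * Wplus \<psi> j k t x p))"
proof (intro ballI allI impI)
  fix j k :: nat and t :: real
  assume j: "j \<in> {1..N}" and k: "k \<in> {1..N}" and t: "t > 0"
  note sd = assms(3) and eq = assms(4)
  let ?\<kappa> = "complex_of_real K / (2 * of_nat N)"
  let ?c = "\<lambda>j k. l2_inner (\<psi> j t) (\<psi> k t)"
  have Cinf_decaying: "Cinf_decaying (\<psi> j s)" if "j \<in> {1..N}" "s > 0" for j s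
    using sd that by (intro smooth_decaying_Cinf_decaying) auto
  note cd = Cinf_decaying_cont_decaying[OF Cinf_decaying]
  have Wp: "Wplus \<psi> j k s x p = 1/2 * W \<psi> j k s x p + 1/2 * W \<psi> k j s x p"
    and Wm: "Wminus \<psi> j k s x p = - \<i>/2 * W \<psi> j k s x p + \<i>/2 * W \<psi> k j s x p"
    if "j \<in> {1..N}" "k \<in> {1..N}" "s > 0" for j k s x p
    by (rule Wplus_eq[where \<psi>=\<psi>, OF cd[OF that(1,3)] cd[OF that(2,3)]])
       (rule Wminus_eq[where \<psi>=\<psi>, OF cd[OF that(1,3)] cd[OF that(2,3)]])
  have Wpt: "Wplus \<psi> j k t = (\<lambda>x p. 1/2 * W \<psi> j k t x p + 1/2 * W \<psi> k j t x p)"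
    and Wmt: "Wminus \<psi> j k t = (\<lambda>x p. - \<i>/2 * W \<psi> j k t x p + \<i>/2 * W \<psi> k j t x p)"
    if "j \<in> {1..N}" "k \<in> {1..N}" for j k
    using Wp[OF that t] Wm[OF that t] by (simp_all add: fun_eq_iff)
  have phi: "phase_integrable (W \<psi> j k t)" "phase_integral (W \<psi> j k t) = ?c j k"
    if "j \<in> {1..N}" "k \<in> {1..N}" for j k
    using that Cinf_decaying t unfolding W_def
    by (auto intro: phase_integrable_wigner phase_integral_wigner)
  have php: "phase_integrable (Wplus \<psi> j k t)" "phase_integrable (Wminus \<psi> j k t)"
    and phv: "phase_integral (Wplus \<psi> j k t) = 1/2 * ?c j k + 1/2 * ?c k j"
       "phase_integral (Wminus \<psi> j k t) = - \<i>/2 * ?c j k + \<i>/2 * ?c k j"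
    if "j \<in> {1..N}" "k \<in> {1..N}" for j k
    unfolding Wpt[OF that] Wmt[OF that] using phi that
    by (simp_all only: phase_integrable_lincomb phase_integral_lincomb)
  have phs: "phase_integral (\<lambda>x p. Wplus \<psi> j l t x p + Wplus \<psi> l k t x p)
      = phase_integral (Wplus \<psi> j l t) + phase_integral (Wplus \<psi> l k t)"
    "phase_integral (\<lambda>x p. Wminus \<psi> j l t x p + Wminus \<psi> l k t x p)
      = phase_integral (Wminus \<psi> j l t) + phase_integral (Wminus \<psi> l k t)" if l: "l \<in> {1..N}" for l
    using phase_integral_lincomb[OF php(1)[OF j l] php(1)[OF l k], of 1 1]
      phase_integral_lincomb[OF php(2)[OF j l] php(2)[OF l k], of 1 1] by simp_all
  note te = transport_exists_W[OF sd eq t]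
  note tr = transport_W[OF sd eq t]
  have tp: "transport_exists V (Wplus \<psi> j k) t x p"
     "transport V (Wplus \<psi> j k) t x p = 1/2 * transport V (W \<psi> j k) t x p + 1/2 * transport V (W \<psi> k j) t x p" for x p
    using transport_exists_lincomb[OF te[OF j k, of x p] te[OF k j, of x p], where \<alpha>="1/2" and \<beta>="1/2"]
       transport_lincomb[OF te[OF j k, of x p] te[OF k j, of x p], where \<alpha>="1/2" and \<beta>="1/2"]
       transport_cong[of "Wplus \<psi> j k" "\<lambda>s x p. 1/2 * W \<psi> j k s x p + 1/2 * W \<psi> k j s x p", OF Wp[OF j k] t]
    by simp_all
  have tm: "transport_exists V (Wminus \<psi> j k) t x p"
     "transport V (Wminus \<psi> j k) t x p = - \<i>/2 * transport V (W \<psi> j k) t x p + \<i>/2 * transport V (W \<psi> k j) t x p" for x p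
    using transport_exists_lincomb[OF te[OF j k, of x p] te[OF k j, of x p], where \<alpha>="- \<i>/2" and \<beta>="\<i>/2"]
       transport_lincomb[OF te[OF j k, of x p] te[OF k j, of x p], where \<alpha>="- \<i>/2" and \<beta>="\<i>/2"]
       transport_cong[of "Wminus \<psi> j k" "\<lambda>s x p. - \<i>/2 * W \<psi> j k s x p + \<i>/2 * W \<psi> k j s x p", OF Wm[OF j k] t]
    by simp_all
  \<comment> \<open>Reduces both remaining equations to identities between the summands.\<close>
  have comb: "\<alpha> * (?\<kappa> * (\<Sum>l=1..N. a l)) + \<beta> * (?\<kappa> * (\<Sum>l=1..N. b l)) = ?\<kappa> * (\<Sum>l=1..N. r l)"
    if "\<And>l. l \<in> {1..N} \<Longrightarrow> \<alpha> * a l + \<beta> * b l = r l" for \<alpha> \<beta> a b r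
  proof -
    have "\<alpha> * (?\<kappa> * (\<Sum>l=1..N. a l)) + \<beta> * (?\<kappa> * (\<Sum>l=1..N. b l)) = ?\<kappa> * (\<Sum>l=1..N. \<alpha> * a l + \<beta> * b l)"
      by (simp only: sum.distrib sum_distrib_left[symmetric] distrib_left mult.left_commute)
    then show ?thesis using that by simp
  qed
  have "transport V (W \<psi> j j) t x p =
        of_real K / of_nat N *
        (\<Sum>l=1..N. Wplus \<psi> j l t x p - phase_integral (Wplus \<psi> j l t) * W \<psi> j j t x p)" for x p
  proof -
    have "(\<Sum>l=1..N. Wplus \<psi> j l t x p - phase_integral (Wplus \<psi> j l t) * W \<psi> j j t x p)
       = 1/2 * (\<Sum>l=1..N. W \<psi> l j t x p + W \<psi> j l t x p - (?c j l + ?c l j) * W \<psi> j j t x p)"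
      unfolding sum_distrib_left by (intro sum.cong refl) (simp only: Wp phv j t, simp add: algebra_simps)
    then show ?thesis
      unfolding tr[OF j j] by (simp only:) simp
  qed
  moreover have "transport V (Wplus \<psi> j k) t x p =
        of_real K / (2 * of_nat N) *
        (\<Sum>l=1..N. Wplus \<psi> j l t x p + Wplus \<psi> l k t x p
          - phase_integral (\<lambda>x p. Wplus \<psi> j l t x p + Wplus \<psi> l k t x p) * Wplus \<psi> j k t x p
          + phase_integral (\<lambda>x p. Wminus \<psi> j l t x p + Wminus \<psi> l k t x p) * Wminus \<psi> j k t x p)" for x p
    unfolding tp(2) tr[OF j k] tr[OF k j]
    by (rule comb) (simp only: phs phv j k, simp only: Wp Wm j k t, simp add: field_simps)
  moreover have "transport V (Wminus \<psi> j k) t x p =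
        of_real K / (2 * of_nat N) *
        (\<Sum>l=1..N. Wminus \<psi> j l t x p + Wminus \<psi> l k t x p
          - phase_integral (\<lambda>x p. Wplus \<psi> j l t x p + Wplus \<psi> l k t x p) * Wminus \<psi> j k t x p
          - phase_integral (\<lambda>x p. Wminus \<psi> j l t x p + Wminus \<psi> l k t x p) * Wplus \<psi> j k t x p)" for x p
    unfolding tm(2) tr[OF j k] tr[OF k j]
    by (rule comb) (simp only: phs phv j k, simp only: Wp Wm j k t, simp add: field_simps)
  ultimately show "phase_integrable (Wplus \<psi> j k t) \<and> phase_integrable (Wminus \<psi> j k t) \<and>
    (\<forall>x p.
      transport_exists V (W \<psi> j j) t x p \<and>
      transport_exists V (Wplus \<psi> j k) t x p \<and>
      transport_exists V (Wminus \<psi> j k) t x p \<and>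
      transport V (W \<psi> j j) t x p =
        of_real K / of_nat N *
        (\<Sum>l=1..N. Wplus \<psi> j l t x p - phase_integral (Wplus \<psi> j l t) * W \<psi> j j t x p) \<and>
      transport V (Wplus \<psi> j k) t x p =
        of_real K / (2 * of_nat N) *
        (\<Sum>l=1..N. Wplus \<psi> j l t x p + Wplus \<psi> l k t x p
          - phase_integral (\<lambda>x p. Wplus \<psi> j l t x p + Wplus \<psi> l k t x p) * Wplus \<psi> j k t x p
          + phase_integral (\<lambda>x p. Wminus \<psi> j l t x p + Wminus \<psi> l k t x p) * Wminus \<psi> j k t x p) \<and>
      transport V (Wminus \<psi> j k) t x p =
        of_real K / (2 * of_nat N) *
        (\<Sum>l=1..N. Wminus \<psi> j l t x p + Wminus \<psi> l k t x p
          - phase_integral (\<lambda>x p. Wplus \<psi> j l t x p + Wplus \<psi> l k t x p) * Wminus \<psi> j k t x p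
          - phase_integral (\<lambda>x p. Wminus \<psi> j l t x p + Wminus \<psi> l k t x p) * Wplus \<psi> j k t x p))"
    using php[OF j k] te[OF j j] tp(1) tm(1) by blast
qed

end
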